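(* Let $\Omega,\Omega',S$ be non-empty sets, $(\mathscr A,m)\in\mathscr M(\Omega)$, $X:\Omega\to S$, $X':\Omega'\to S$, and let $\mathscr H$ be a Stonean vector sublattice of the space of all functions $S\to\mathbb R$. There is equivalence between the condition $$\int h(X)\,dm<0\ \text{ implies }\ \inf_{\omega'\in\Omega'}h\big(X'(\omega')\big)<0\qquad\text{for all }h\in\mathscr H\text{ with }h(X)\in L^1(m)$$ and the existence of a minimal $(\mathscr R,\mu)\in\mathscr M(\Omega')$ satisfying $$h(X')\in L^1(\mu)\ \text{ and }\ \int h(X)\,dm=\int h(X')\,d\mu\qquad\text{for all }h\in\mathscr H\text{ with }h(X)\in L^1(m).$$ In addition: (a) $\mu$ is a probability if and only if $$\int h(X)\,dm\ge\inf_{\omega'\in\Omega'}h\big(X'(\omega')\big)\qquad\text{for all }h\in\mathscr H\text{ with }h(X)\in L^1(m);$$ (b) if $S$ is a topological space, $X'[\Omega']$ is closed in $S$ and all functions in $\mathscr H$ are continuous, then $\mu$ is countably additive if either (i) every function in $\mathscr H$ is continuous with compact support, or (ii) $X'$ is $\mu$-tight, or (iii) $X$ is $m$-tight and $m_*\big(X\notin X'[\Omega']\big)=0$.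
   Context: A family $\mathscr H$ of real functions is Stonean if $h\in\mathscr H$ implies $h\wedge1\in\mathscr H$. $X'[\Omega']$ denotes the image of $\Omega'$ under $X'$. Finitely additive integration. A measure structure on $\Omega$ is a pair $(\mathscr A,\lambda)$ with $\mathscr A$ a ring of subsets of $\Omega$ and $\lambda:\mathscr A\to[0,\infty)$ finitely additive; $\mathscr M(\Omega)$ is the collection of all of them. $\mathscr S(\mathscr A)$ is the linear span of the indicators of members of $\mathscr A$, with the obvious integral. For $E\subset\Omega$, $\lambda^*(E)=\inf\{\lambda(A):A\in\mathscr A, E\subset A\}$ (with $\inf\varnothing=\infty$) and $\lambda_*(E)=\sup\{\lambda(B):B\in\mathscr A,B\subset E\}$. $X_n$ $\lambda$-converges to $X$ if $\lim_n\lambda^*(|X_n-X|>c)=0$ for every $c>0$. $X\in L^1(\lambda)$ if there is a sequence $X_n\in\mathscr S(\mathscr A)$ that $\lambda$-converges to $X$ and is Cauchy in the sense $\int|X_n-X_k|\,d\lambda\to0$ as $n,k\to\infty$; then $\int X\,d\lambda=\lim_n\int X_n\,d\lambda$. $\lambda$ is a probability if $\sup_{A\in\mathscr A}\lambda(A)=1$; it is countably additive if $\lambda(\bigcup_nA_n)=\sum_n\lambda(A_n)$ for disjoint $A_n\in\mathscr A$ with $\bigcup_nA_n\in\mathscr A$. A function $Y$ from $\Omega$ into a topological space $S$ is $\lambda$-tight if for every $\varepsilon>0$ there is a compact $K\subset S$ with $\lambda^*(Y\notin K)<\varepsilon$. Order: $\mathscr A(\lambda)=\{E\subset\Omega:\lambda^*(E)=\lambda_*(E)<\infty\}$,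 to which $\lambda$ extends uniquely (extension again denoted $\lambda$). Write $(\mathscr A,\lambda)\preceq(\mathscr B,\xi)$ if $\mathscr A\subset\mathscr B(\xi)$ and $\xi|_{\mathscr A}=\lambda$. A structure with a given property is minimal if it is $\preceq$ every structure with that property.
   Formalization: Part (a) as stated fails (e.g. H={0}): it is replaced by "the inequality holds iff μ extends to a representing probability", the "only if" part in full, and the stated equivalence when some h in H with h(X) in L^1(m) has inf h(X')>0. *)

theory Defs
  imports "HOL-Analysis.Analysis"
begin

section \<open>Finitely additive measure structures\<close>

text \<open>The set functions below are only finitely additive, on a ring of sets, so the
  countably additive integration theory of the library does not apply. Values of a set function
  outside its ring are never used.\<close>

definition measure_structure :: "'a set set \<Rightarrow> ('a set \<Rightarrow> real) \<Rightarrow> bool" where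
  "measure_structure \<A> l \<longleftrightarrow>
     ring_of_sets UNIV \<A> \<and> (\<forall>E\<in>\<A>. 0 \<le> l E) \<and> Measure_Space.additive \<A> l"

definition outer_val :: "'a set set \<Rightarrow> ('a set \<Rightarrow> real) \<Rightarrow> 'a set \<Rightarrow> ennreal" where
  "outer_val \<A> l E = (INF B\<in>{B\<in>\<A>. E \<subseteq> B}. ennreal (l B))"

definition inner_val :: "'a set set \<Rightarrow> ('a set \<Rightarrow> real) \<Rightarrow> 'a set \<Rightarrow> ennreal" where
  "inner_val \<A> l E = (SUP B\<in>{B\<in>\<A>. B \<subseteq> E}. ennreal (l B))"

definition is_probability :: "'a set set \<Rightarrow> ('a set \<Rightarrow> real) \<Rightarrow> bool" where
  "is_probability \<A> l \<longleftrightarrow> (SUP E\<in>\<A>. ennreal (l E)) = 1"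

definition is_countably_additive :: "'a set set \<Rightarrow> ('a set \<Rightarrow> real) \<Rightarrow> bool" where
  "is_countably_additive \<A> l \<longleftrightarrow>
     (\<forall>E :: nat \<Rightarrow> 'a set. range E \<subseteq> \<A> \<longrightarrow> disjoint_family E \<longrightarrow> (\<Union>n. E n) \<in> \<A> \<longrightarrow>
        (\<lambda>n. l (E n)) sums l (\<Union>n. E n))"

definition tight :: "'a set set \<Rightarrow> ('a set \<Rightarrow> real) \<Rightarrow> 's topology \<Rightarrow> ('a \<Rightarrow> 's) \<Rightarrow> bool" where
  "tight \<A> l T Y \<longleftrightarrow>
     (\<forall>\<epsilon>>0. \<exists>K. compactin T K \<and> outer_val \<A> l {w. Y w \<notin> K} < ennreal \<epsilon>)"


section \<open>Integration\<close>

text \<open>The linear span of the indicators of members of the ring, spelled out because functions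
  into the reals are not an instance of \<^class>\<open>real_vector\<close>.\<close>

definition simple_functions :: "'a set set \<Rightarrow> ('a \<Rightarrow> real) set" where
  "simple_functions \<A> =
     {f. \<exists>(n::nat) c E. (\<forall>i<n. E i \<in> \<A>) \<and> f = (\<lambda>w. \<Sum>i<n. c i * indicat_real (E i) w)}"

text \<open>For a simple function the range is finite and the level sets of nonzero values are in the
  ring, so the canonical representation gives the integral.\<close>

definition simple_int :: "('a set \<Rightarrow> real) \<Rightarrow> ('a \<Rightarrow> real) \<Rightarrow> real" where
  "simple_int l f = (\<Sum>y\<in>range f - {0}. y * l (f -` {y}))"

definition converges_in_measure ::
  "'a set set \<Rightarrow> ('a set \<Rightarrow> real) \<Rightarrow> (nat \<Rightarrow> 'a \<Rightarrow> real) \<Rightarrow> ('a \<Rightarrow> real) \<Rightarrow> bool" where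
  "converges_in_measure \<A> l F f \<longleftrightarrow>
     (\<forall>c>0. (\<lambda>n. outer_val \<A> l {w. \<bar>F n w - f w\<bar> > c}) \<longlonglongrightarrow> 0)"

definition approximating ::
  "'a set set \<Rightarrow> ('a set \<Rightarrow> real) \<Rightarrow> ('a \<Rightarrow> real) \<Rightarrow> (nat \<Rightarrow> 'a \<Rightarrow> real) \<Rightarrow> bool" where
  "approximating \<A> l f F \<longleftrightarrow>
     (\<forall>n. F n \<in> simple_functions \<A>) \<and>
     converges_in_measure \<A> l F f \<and>
     (\<forall>\<epsilon>>0. \<exists>N. \<forall>n\<ge>N. \<forall>k\<ge>N. simple_int l (\<lambda>w. \<bar>F n w - F k w\<bar>) < \<epsilon>)"

definition L1 :: "'a set set \<Rightarrow> ('a set \<Rightarrow> real) \<Rightarrow> ('a \<Rightarrow> real) set" where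
  "L1 \<A> l = {f. \<exists>F. approximating \<A> l f F}"

text \<open>The limit does not depend on the approximating sequence; the value outside
  \<^const>\<open>L1\<close> is irrelevant.\<close>

definition fa_integral :: "'a set set \<Rightarrow> ('a set \<Rightarrow> real) \<Rightarrow> ('a \<Rightarrow> real) \<Rightarrow> real" where
  "fa_integral \<A> l f = (THE I. \<exists>F. approximating \<A> l f F \<and> (\<lambda>n. simple_int l (F n)) \<longlonglongrightarrow> I)"


section \<open>Order and minimality\<close>

definition completion_ring :: "'a set set \<Rightarrow> ('a set \<Rightarrow> real) \<Rightarrow> 'a set set" where
  "completion_ring \<A> l = {E. outer_val \<A> l E = inner_val \<A> l E \<and> outer_val \<A> l E < \<infinity>}"

text \<open>The unique monotone extension to \<^const>\<open>completion_ring\<close> is the common value of the outer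
  and the inner set function.\<close>

definition extension :: "'a set set \<Rightarrow> ('a set \<Rightarrow> real) \<Rightarrow> 'a set \<Rightarrow> real" where
  "extension \<A> l E = enn2real (outer_val \<A> l E)"

definition struct_le ::
  "'a set set \<Rightarrow> ('a set \<Rightarrow> real) \<Rightarrow> 'a set set \<Rightarrow> ('a set \<Rightarrow> real) \<Rightarrow> bool" where
  "struct_le \<A> l \<B> x \<longleftrightarrow> \<A> \<subseteq> completion_ring \<B> x \<and> (\<forall>E\<in>\<A>. extension \<B> x E = l E)"

definition minimal_structure ::
  "('a set set \<Rightarrow> ('a set \<Rightarrow> real) \<Rightarrow> bool) \<Rightarrow> 'a set set \<Rightarrow> ('a set \<Rightarrow> real) \<Rightarrow> bool" where
  "minimal_structure P \<R> \<mu> \<longleftrightarrow>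
     measure_structure \<R> \<mu> \<and> P \<R> \<mu> \<and>
     (\<forall>\<B> x. measure_structure \<B> x \<longrightarrow> P \<B> x \<longrightarrow> struct_le \<R> \<mu> \<B> x)"


section \<open>Function lattices and representation\<close>

definition vector_sublattice :: "('s \<Rightarrow> real) set \<Rightarrow> bool" where
  "vector_sublattice H \<longleftrightarrow>
     (\<lambda>s. 0) \<in> H \<and>
     (\<forall>f\<in>H. \<forall>g\<in>H. (\<lambda>s. f s + g s) \<in> H) \<and>
     (\<forall>f\<in>H. \<forall>c. (\<lambda>s. c * f s) \<in> H) \<and>
     (\<forall>f\<in>H. \<forall>g\<in>H. (\<lambda>s. max (f s) (g s)) \<in> H \<and> (\<lambda>s. min (f s) (g s)) \<in> H)"

definition stonean :: "('s \<Rightarrow> real) set \<Rightarrow> bool" where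
  "stonean H \<longleftrightarrow> (\<forall>h\<in>H. (\<lambda>s. min (h s) 1) \<in> H)"

definition integrable_part ::
  "('s \<Rightarrow> real) set \<Rightarrow> 'a set set \<Rightarrow> ('a set \<Rightarrow> real) \<Rightarrow> ('a \<Rightarrow> 's) \<Rightarrow> ('s \<Rightarrow> real) set" where
  "integrable_part H \<A> m X = {h\<in>H. (\<lambda>w. h (X w)) \<in> L1 \<A> m}"

definition represents ::
  "('s \<Rightarrow> real) set \<Rightarrow> 'a set set \<Rightarrow> ('a set \<Rightarrow> real) \<Rightarrow> ('a \<Rightarrow> 's) \<Rightarrow> ('b \<Rightarrow> 's) \<Rightarrow>
     'b set set \<Rightarrow> ('b set \<Rightarrow> real) \<Rightarrow> bool" where
  "represents H \<A> m X X' \<R> \<mu> \<longleftrightarrow>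
     (\<forall>h\<in>integrable_part H \<A> m X.
        (\<lambda>w. h (X' w)) \<in> L1 \<R> \<mu> \<and>
        fa_integral \<A> m (\<lambda>w. h (X w)) = fa_integral \<R> \<mu> (\<lambda>w. h (X' w)))"

text \<open>Infima are taken in \<^typ>\<open>ereal\<close>, since the functions need not be bounded below.\<close>

definition inf_on_image :: "('s \<Rightarrow> real) \<Rightarrow> ('b \<Rightarrow> 's) \<Rightarrow> ereal" where
  "inf_on_image h X' = (INF w. ereal (h (X' w)))"

definition compact_support :: "'s topology \<Rightarrow> ('s \<Rightarrow> real) \<Rightarrow> bool" where
  "compact_support T h \<longleftrightarrow> compactin T (T closure_of {s. h s \<noteq> 0})"

end

theory Submission
  imports Defs
begin

text \<open>The condition says exactly that \<open>h \<mapsto> \<integral>h(X) dm\<close> depends only on \<open>h(X')\<close> and induces a positive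
  functional \<open>\<phi>\<close> on the Stonean lattice \<open>L\<close> of the functions \<open>h(X')\<close>. The minimal structure consists
  of the sets \<open>E\<close> that are measurable in the sense of Jordan with respect to \<open>\<phi>\<close>: their indicators
  are squeezed between members of \<open>L\<close> with arbitrarily close values of \<open>\<phi>\<close>. Chebyshev's inequality,
  applied in any structure that represents \<open>\<phi>\<close>, shows that such a set is measurable there with the
  same content, which is minimality. For \<open>f \<ge> 0\<close> in \<open>L\<close> the set \<open>{f > t}\<close> is squeezed between the
  difference quotients of \<open>t \<mapsto> f \<and> t\<close>, so it is Jordan measurable at every continuity point of the
  monotone function \<open>t \<mapsto> \<phi>\<^sup>*{f > t}\<close>. Hence \<open>f\<close> is integrable with integral \<open>\<phi> f\<close>, since \<open>\<phi>\<close> inherits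
  \<open>\<phi>(f \<and> \<delta>) \<rightarrow> 0\<close> and \<open>\<phi>(f \<and> M) \<rightarrow> \<phi> f\<close> from the integral. Countable additivity reduces to
  \<open>\<phi>(k\<^sub>n) \<rightarrow> 0\<close> for sequences in \<open>L\<close> decreasing to \<open>0\<close>, which is Dini's theorem on a compact set.\<close>

section \<open>Simple functions\<close>

text \<open>Sets are therefore squeezed by single members of \<open>L\<close>, and an individual
  level set may fail to be measurable; what saves the construction is that between two positive
  levels there is always a good one. Moreover the ring need not contain the whole space, so
  constants need not be integrable. Hence zero level sets of simple functions are exempted
  throughout, and total mass is delicate in (a): if no function in \<open>L\<close> has a positive
  lower bound, \<open>L\<close> does not determine the total mass, and the missing mass is placed on
  complements of ring sets. Countable additivity has an obstacle of its own: Dini's theorem is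
  applied on \<open>S\<close>, whereas members of \<open>L\<close> determine functions on
  \<open>S\<close> only along the image of \<open>X'\<close>. A decreasing sequence in
  \<open>L\<close> must be lifted to one that decreases on all of \<open>S\<close>, and under (iii)
  the estimate is made on the side of \<open>X\<close>, where the image is reached only up to a set
  of inner content 0.\<close>

lemma ennreal_tendsto_0_iff:
  fixes u :: "nat \<Rightarrow> ennreal"
  shows "u \<longlonglongrightarrow> 0 \<longleftrightarrow> (\<forall>\<epsilon>>0. \<exists>N. \<forall>n\<ge>N. u n < ennreal \<epsilon>)"
proof
  assume "u \<longlonglongrightarrow> 0"
  then show "\<forall>\<epsilon>>0. \<exists>N. \<forall>n\<ge>N. u n < ennreal \<epsilon>"
    using order_tendstoD(2)[of u 0 sequentially] by (auto simp: eventually_sequentially)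
next
  assume *: "\<forall>\<epsilon>>0. \<exists>N. \<forall>n\<ge>N. u n < ennreal \<epsilon>"
  show "u \<longlonglongrightarrow> 0"
  proof (rule order_tendstoI)
    fix a :: ennreal assume "0 < a"
    then obtain e where e: "0 < e" "e < a" using dense by blast
    then obtain r where r: "e = ennreal r" "0 < r"
      by (cases e) (auto simp: ennreal_zero_less_top)
    with * obtain N where "\<forall>n\<ge>N. u n < e" by blast
    then show "\<forall>\<^sub>F n in sequentially. u n < a"
      using e by (auto simp: eventually_sequentially intro: less_trans)
  qed simp
qed

locale finadd =
  fixes \<A> :: "'a set set" and l :: "'a set \<Rightarrow> real"
  assumes measure_structure: "measure_structure \<A> l"
begin

sublocale ring_of_sets UNIV \<A>
  using measure_structure by (simp add: measure_structure_def)

lemma nonneg: "E \<in> \<A> \<Longrightarrow> 0 \<le> l E"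
  using measure_structure by (simp add: measure_structure_def)

lemma add_disjoint: "\<lbrakk>E \<in> \<A>; F \<in> \<A>; E \<inter> F = {}\<rbrakk> \<Longrightarrow> l (E \<union> F) = l E + l F"
  using measure_structure by (simp add: measure_structure_def Measure_Space.additive_def)

lemma l_empty [simp]: "l {} = 0"
  using add_disjoint[of "{}" "{}"] by simp

lemma mono_l:
  assumes "E \<in> \<A>" "F \<in> \<A>" "E \<subseteq> F"
  shows "l E \<le> l F"
proof -
  have "l F = l E + l (F - E)"
    using add_disjoint[of E "F - E"] assms by (simp add: Un_absorb1 Diff)
  then show ?thesis
    using nonneg[of "F - E"] assms by auto
qed

lemma subadditive_l:
  assumes "E \<in> \<A>" "F \<in> \<A>"
  shows "l (E \<union> F) \<le> l E + l F"
  using add_disjoint[of E "F - E"] mono_l[of "F - E" F] Diff[of F E] assms by auto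

lemma sum_disjoint:
  assumes "finite I" "\<And>i. i \<in> I \<Longrightarrow> B i \<in> \<A>" "disjoint_family_on B I"
  shows "(\<Union>i\<in>I. B i) \<in> \<A>" "l (\<Union>i\<in>I. B i) = (\<Sum>i\<in>I. l (B i))"
proof -
  have "(\<Union>i\<in>I. B i) \<in> \<A> \<and> l (\<Union>i\<in>I. B i) = (\<Sum>i\<in>I. l (B i))"
    using assms
  proof (induction I rule: finite_induct)
    case (insert i I)
    then have "disjoint_family_on B I" "B i \<inter> (\<Union>i\<in>I. B i) = {}"
      by (auto simp: disjoint_family_on_def)
    with insert show ?case
      by (simp add: add_disjoint Un)
  qed auto
  then show "(\<Union>i\<in>I. B i) \<in> \<A>" "l (\<Union>i\<in>I. B i) = (\<Sum>i\<in>I. l (B i))"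
    by auto
qed

text \<open>The integral of a function of \<open>p\<close> can be computed on the partition by the
  levels of \<open>p\<close> instead of its own, coarser one: group the levels of \<open>p\<close>
  by the value of \<phi>. The value \<open>c0\<close> is left out because its level need not belong
  to the ring, and \<phi> vanishes there.\<close>

lemma compose_finite_range:
  fixes p :: "'a \<Rightarrow> 'c" and \<phi> :: "'c \<Rightarrow> real"
  assumes fin: "finite (range p)" and lev: "\<And>c. c \<noteq> c0 \<Longrightarrow> p -` {c} \<in> \<A>" and z: "\<phi> c0 = 0"
  shows "y \<noteq> 0 \<Longrightarrow> (\<lambda>w. \<phi> (p w)) -` {y} \<in> \<A>"
    and "simple_int l (\<lambda>w. \<phi> (p w)) = (\<Sum>c\<in>range p - {c0}. \<phi> c * l (p -` {c}))"
proof -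
  define S where "S = {c \<in> range p - {c0}. \<phi> c \<noteq> 0}"
  have finS: "finite S" using fin by (simp add: S_def)
  have eq: "(\<lambda>w. \<phi> (p w)) -` {y} = (\<Union>c\<in>{c\<in>S. \<phi> c = y}. p -` {c})" if "y \<noteq> 0" for y
    using that z by (auto simp: S_def)
  have dis: "disjoint_family_on (\<lambda>c. p -` {c}) T" for T
    by (auto simp: disjoint_family_on_def)
  have S': "p -` {c} \<in> \<A>" if "c \<in> S" for c
    using that lev by (auto simp: S_def)
  show "(\<lambda>w. \<phi> (p w)) -` {y} \<in> \<A>" if "y \<noteq> 0" for y
    unfolding eq[OF that] using finS by (intro sum_disjoint dis) (auto intro: S')
  have "simple_int l (\<lambda>w. \<phi> (p w)) =
      (\<Sum>y\<in>range (\<lambda>w. \<phi> (p w)) - {0}. \<Sum>c\<in>{c\<in>S. \<phi> c = y}. \<phi> c * l (p -` {c}))"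
    unfolding simple_int_def
  proof (intro sum.cong refl)
    fix y assume "y \<in> range (\<lambda>w. \<phi> (p w)) - {0}"
    then have "y \<noteq> 0" by simp
    have "l (\<Union>c\<in>{c\<in>S. \<phi> c = y}. p -` {c}) = (\<Sum>c\<in>{c\<in>S. \<phi> c = y}. l (p -` {c}))"
      using finS by (intro sum_disjoint dis) (auto intro: S')
    then show "y * l ((\<lambda>w. \<phi> (p w)) -` {y}) = (\<Sum>c\<in>{c\<in>S. \<phi> c = y}. \<phi> c * l (p -` {c}))"
      unfolding eq[OF \<open>y \<noteq> 0\<close>] by (simp add: sum_distrib_left)
  qed
  also have "\<dots> = (\<Sum>c\<in>S. \<phi> c * l (p -` {c}))"
  proof (rule sum.group[OF finS])
    have "range (\<lambda>w. \<phi> (p w)) = \<phi> ` range p" by auto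
    with fin show "finite (range (\<lambda>w. \<phi> (p w)) - {0})" by simp
  qed (auto simp: S_def)
  also have "\<dots> = (\<Sum>c\<in>range p - {c0}. \<phi> c * l (p -` {c}))"
    using fin by (intro sum.mono_neutral_left) (auto simp: S_def)
  finally show "simple_int l (\<lambda>w. \<phi> (p w)) = (\<Sum>c\<in>range p - {c0}. \<phi> c * l (p -` {c}))" .
qed

text \<open>A description of simple functions that does not refer to a representation. The level of
  0 is exempt since the ring may lack the whole space.\<close>

definition levels_in_ring :: "('a \<Rightarrow> real) \<Rightarrow> bool" where
  "levels_in_ring f \<longleftrightarrow> finite (range f) \<and> (\<forall>y. y \<noteq> 0 \<longrightarrow> f -` {y} \<in> \<A>)"

lemma levels_support:
  assumes "levels_in_ring f"
  shows "{w. f w \<noteq> 0} \<in> \<A>"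
proof -
  have "{w. f w \<noteq> 0} = (\<Union>y\<in>range f - {0}. f -` {y})" by auto
  then show ?thesis
    using assms by (auto simp: levels_in_ring_def intro!: finite_UN)
qed

text \<open>The common refinement of two level partitions. If one coordinate is 0, its level may lie
  outside the ring, but the joint level is the other level minus a support, and supports are in the
  ring.\<close>

lemma levels_pair:
  assumes "levels_in_ring f" "levels_in_ring g"
  shows "finite (range (\<lambda>w. (f w, g w)))"
    and "c \<noteq> (0, 0) \<Longrightarrow> (\<lambda>w. (f w, g w)) -` {c} \<in> \<A>"
proof -
  have "range (\<lambda>w. (f w, g w)) \<subseteq> range f \<times> range g" by auto
  with assms show "finite (range (\<lambda>w. (f w, g w)))"
    unfolding levels_in_ring_def by (metis finite_SigmaI finite_subset)
  show "(\<lambda>w. (f w, g w)) -` {c} \<in> \<A>" if "c \<noteq> (0, 0)" for c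
  proof (cases c)
    case (Pair y z)
    have l: "f -` {y} \<in> \<A>" if "y \<noteq> 0" using that assms by (simp add: levels_in_ring_def)
    have r: "g -` {z} \<in> \<A>" if "z \<noteq> 0" using that assms by (simp add: levels_in_ring_def)
    consider "y \<noteq> 0" "z \<noteq> 0" | "y \<noteq> 0" "z = 0" | "y = 0" "z \<noteq> 0"
      using \<open>c \<noteq> (0, 0)\<close> Pair by blast
    then show ?thesis
    proof cases
      case 1
      have "(\<lambda>w. (f w, g w)) -` {c} = f -` {y} \<inter> g -` {z}" using Pair by auto
      then show ?thesis using l r 1 by auto
    next
      case 2
      have "(\<lambda>w. (f w, g w)) -` {c} = f -` {y} - {w. g w \<noteq> 0}" using Pair 2 by auto
      then show ?thesis using l 2 levels_support[OF assms(2)] by auto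
    next
      case 3
      have "(\<lambda>w. (f w, g w)) -` {c} = g -` {z} - {w. f w \<noteq> 0}" using Pair 3 by auto
      then show ?thesis using r 3 levels_support[OF assms(1)] by auto
    qed
  qed
qed

lemma levels_binop:
  assumes "levels_in_ring f" "levels_in_ring g" "\<phi> 0 0 = 0"
  shows "levels_in_ring (\<lambda>w. \<phi> (f w) (g w))"
proof -
  have "range (\<lambda>w. \<phi> (f w) (g w)) = (\<lambda>(a, b). \<phi> a b) ` range (\<lambda>w. (f w, g w))"
    by auto
  then have "finite (range (\<lambda>w. \<phi> (f w) (g w)))"
    using levels_pair(1)[OF assms(1,2)] by simp
  then show ?thesis
    using compose_finite_range(1)[of "\<lambda>w. (f w, g w)" "(0, 0)" "\<lambda>(a, b). \<phi> a b"]
      levels_pair[OF assms(1,2)] assms(3)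
    by (simp add: levels_in_ring_def)
qed

lemma levels_indicator: "E \<in> \<A> \<Longrightarrow> levels_in_ring (\<lambda>w. c * indicat_real E w)"
proof -
  assume E: "E \<in> \<A>"
  have "range (\<lambda>w. c * indicat_real E w) \<subseteq> {0, c}"
    by (auto simp: indicator_def)
  then have "finite (range (\<lambda>w. c * indicat_real E w))"
    by (rule finite_subset) simp
  moreover have "(\<lambda>w. c * indicat_real E w) -` {y} = (if y = c then E else {})" if "y \<noteq> 0" for y
    using that by (auto simp: indicator_def)
  ultimately show ?thesis
    using E by (auto simp: levels_in_ring_def)
qed

lemma simple_iff_levels: "f \<in> simple_functions \<A> \<longleftrightarrow> levels_in_ring f"
proof
  assume "f \<in> simple_functions \<A>"
  then obtain n :: nat and c E where "\<forall>i<n. E i \<in> \<A>"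
    and f: "f = (\<lambda>w. \<Sum>i<n. c i * indicat_real (E i) w)"
    by (auto simp: simple_functions_def)
  then have "levels_in_ring (\<lambda>w. \<Sum>i<n. c i * indicat_real (E i) w)"
  proof (induction n arbitrary: f)
    case 0
    then show ?case by (simp add: levels_in_ring_def vimage_def)
  next
    case (Suc n)
    then show ?case
      using levels_binop[where \<phi> = "(+)", OF _ levels_indicator[of "E n" "c n"]] by simp
  qed
  then show "levels_in_ring f" using f by simp
next
  assume f: "levels_in_ring f"
  then have fin: "finite (range f - {0})" by (simp add: levels_in_ring_def)
  obtain b where b: "bij_betw b {..<card (range f - {0})} (range f - {0})"
    using ex_bij_betw_nat_finite[OF fin] by (auto simp: atLeast0LessThan)
  have "f w = (\<Sum>i<card (range f - {0}). b i * indicat_real (f -` {b i}) w)" for w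
  proof -
    have "(\<Sum>i<card (range f - {0}). b i * indicat_real (f -` {b i}) w)
        = (\<Sum>y\<in>range f - {0}. y * indicat_real (f -` {y}) w)"
      by (rule sum.reindex_bij_betw[OF b])
    also have "\<dots> = (\<Sum>y\<in>range f - {0}. if f w = y then f w else 0)"
      by (intro sum.cong refl) (auto simp: indicator_def)
    also have "\<dots> = f w"
      using fin by (auto simp: sum.delta)
    finally show ?thesis by simp
  qed
  moreover have "f -` {b i} \<in> \<A>" if "i < card (range f - {0})" for i
    using f bij_betwE[OF b] that by (auto simp: levels_in_ring_def)
  ultimately show "f \<in> simple_functions \<A>"
    unfolding simple_functions_def
    by (intro CollectI exI[of _ "card (range f - {0})"] exI[of _ b] exI[of _ "\<lambda>i. f -` {b i}"]
        conjI ext) auto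
qed

lemma simple_binop:
  assumes "f \<in> simple_functions \<A>" "g \<in> simple_functions \<A>" "\<phi> 0 0 = 0"
  shows "(\<lambda>w. \<phi> (f w) (g w)) \<in> simple_functions \<A>"
  using assms levels_binop by (simp add: simple_iff_levels)

lemma simple_unop:
  assumes "f \<in> simple_functions \<A>" "\<phi> 0 = 0"
  shows "(\<lambda>w. \<phi> (f w)) \<in> simple_functions \<A>"
  using simple_binop[of f f "\<lambda>a b. \<phi> a"] assms by simp

lemma simple_indicator: "E \<in> \<A> \<Longrightarrow> indicat_real E \<in> simple_functions \<A>"
  using levels_indicator[of E 1] by (simp add: simple_iff_levels)

lemma simple_level_gt:
  assumes "f \<in> simple_functions \<A>" "0 < c"
  shows "{w. c < f w} \<in> \<A>"
proof -
  have "(\<lambda>w. if c < f w then 1 else 0) \<in> simple_functions \<A>"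
    using simple_unop[of f "\<lambda>y. if c < y then 1 else 0"] assms by simp
  from levels_support[OF this[unfolded simple_iff_levels]]
  have "{w. (if c < f w then 1 else (0::real)) \<noteq> 0} \<in> \<A>" .
  moreover have "{w. (if c < f w then 1 else (0::real)) \<noteq> 0} = {w. c < f w}" by auto
  ultimately show ?thesis by simp
qed

lemma simple_support: "f \<in> simple_functions \<A> \<Longrightarrow> {w. f w \<noteq> 0} \<in> \<A>"
  using levels_support by (simp add: simple_iff_levels)

lemma simple_bounded:
  assumes "f \<in> simple_functions \<A>"
  obtains M where "0 < M" "\<And>w. \<bar>f w\<bar> \<le> M"
proof -
  have "finite (range f)" using assms by (simp add: simple_iff_levels levels_in_ring_def)
  then have "bounded (range f)" by (rule finite_imp_bounded)
  then show ?thesis using that by (auto simp: bounded_pos)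
qed

text \<open>Puts all functions of the pair on one common partition. Taking projections, sums and
  multiples for \<phi> then reduces linearity and monotonicity of the integral to facts about finite
  sums.\<close>

lemma simple_int_binop:
  fixes \<phi> :: "real \<Rightarrow> real \<Rightarrow> real"
  assumes "f \<in> simple_functions \<A>" "g \<in> simple_functions \<A>" "\<phi> 0 0 = 0"
  shows "simple_int l (\<lambda>w. \<phi> (f w) (g w)) =
    (\<Sum>c\<in>range (\<lambda>w. (f w, g w)) - {(0, 0)}. \<phi> (fst c) (snd c) * l ((\<lambda>w. (f w, g w)) -` {c}))"
  using compose_finite_range(2)[of "\<lambda>w. (f w, g w)" "(0, 0)" "\<lambda>c. \<phi> (fst c) (snd c)"]
    levels_pair[of f g] assms
  by (simp add: simple_iff_levels)

lemma simple_int_add: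
  assumes "f \<in> simple_functions \<A>" "g \<in> simple_functions \<A>"
  shows "simple_int l (\<lambda>w. f w + g w) = simple_int l f + simple_int l g"
  using simple_int_binop[OF assms, of "\<lambda>a b. a"] simple_int_binop[OF assms, of "\<lambda>a b. b"]
    simple_int_binop[OF assms, of "(+)"]
  by (simp add: sum.distrib distrib_right)

lemma simple_int_cmult:
  assumes "f \<in> simple_functions \<A>"
  shows "simple_int l (\<lambda>w. c * f w) = c * simple_int l f"
  using simple_int_binop[OF assms assms, of "\<lambda>a b. a"]
    simple_int_binop[OF assms assms, of "\<lambda>a b. c * a"]
  by (simp add: sum_distrib_left mult.assoc)

lemma simple_int_mono:
  assumes "f \<in> simple_functions \<A>" "g \<in> simple_functions \<A>" "\<And>w. f w \<le> g w"
  shows "simple_int l f \<le> simple_int l g"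
proof -
  have "(\<Sum>c\<in>range (\<lambda>w. (f w, g w)) - {(0, 0)}. fst c * l ((\<lambda>w. (f w, g w)) -` {c}))
    \<le> (\<Sum>c\<in>range (\<lambda>w. (f w, g w)) - {(0, 0)}. snd c * l ((\<lambda>w. (f w, g w)) -` {c}))"
    using levels_pair(2)[of f g] assms
    by (intro sum_mono mult_right_mono nonneg) (auto simp: simple_iff_levels)
  then show ?thesis
    using simple_int_binop[OF assms(1,2), of "\<lambda>a b. a"] simple_int_binop[OF assms(1,2), of "\<lambda>a b. b"]
    by simp
qed

lemma simple_int_diff:
  assumes "f \<in> simple_functions \<A>" "g \<in> simple_functions \<A>"
  shows "simple_int l (\<lambda>w. f w - g w) = simple_int l f - simple_int l g"
  using simple_int_add[OF assms(1) simple_unop[OF assms(2), of "\<lambda>y. - 1 * y"]]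
    simple_int_cmult[OF assms(2), of "- 1"] by simp

lemma simple_zero: "(\<lambda>w. 0) \<in> simple_functions \<A>"
  by (simp add: simple_iff_levels levels_in_ring_def vimage_def)

lemma simple_int_zero [simp]: "simple_int l (\<lambda>w. 0) = 0"
  by (simp add: simple_int_def)

lemma simple_int_nonneg:
  assumes "f \<in> simple_functions \<A>" "\<And>w. 0 \<le> f w"
  shows "0 \<le> simple_int l f"
  using simple_int_mono[OF simple_zero assms] by simp

lemma abs_simple_int_le:
  assumes "f \<in> simple_functions \<A>"
  shows "\<bar>simple_int l f\<bar> \<le> simple_int l (\<lambda>w. \<bar>f w\<bar>)"
proof -
  have a: "(\<lambda>w. \<bar>f w\<bar>) \<in> simple_functions \<A>" "(\<lambda>w. - 1 * f w) \<in> simple_functions \<A>"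
    using assms by (auto intro: simple_unop)
  have "simple_int l f \<le> simple_int l (\<lambda>w. \<bar>f w\<bar>)"
    by (rule simple_int_mono[OF assms a(1)]) simp
  moreover have "simple_int l (\<lambda>w. - 1 * f w) \<le> simple_int l (\<lambda>w. \<bar>f w\<bar>)"
    by (rule simple_int_mono[OF a(2) a(1)]) simp
  ultimately show ?thesis
    using simple_int_cmult[OF assms, of "- 1"] by simp
qed

lemma simple_int_indicator:
  assumes "E \<in> \<A>"
  shows "simple_int l (indicat_real E) = l E"
proof -
  have "range (indicat_real E) - {0} = (if E = {} then {} else {1})"
    by (auto simp: indicator_def image_iff)
  moreover have "indicat_real E -` {1} = E" by (auto simp: indicator_def)
  ultimately show ?thesis by (simp add: simple_int_def)
qed


section \<open>The integral\<close>

lemma outer_less: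
  assumes "outer_val \<A> l E < ennreal r"
  obtains B where "B \<in> \<A>" "E \<subseteq> B" "l B < r"
  using assms nonneg by (auto simp: outer_val_def INF_less_iff ennreal_less_iff)

lemma outer_le: "\<lbrakk>B \<in> \<A>; E \<subseteq> B\<rbrakk> \<Longrightarrow> outer_val \<A> l E \<le> ennreal (l B)"
  unfolding outer_val_def by (intro INF_lower) simp

lemma inner_ge: "\<lbrakk>B \<in> \<A>; B \<subseteq> E\<rbrakk> \<Longrightarrow> ennreal (l B) \<le> inner_val \<A> l E"
  unfolding inner_val_def by (intro SUP_upper) simp

lemma inner_greater:
  assumes "ennreal r < inner_val \<A> l E" "0 \<le> r"
  obtains B where "B \<in> \<A>" "B \<subseteq> E" "r < l B"
  using assms by (auto simp: inner_val_def less_SUP_iff ennreal_less_iff)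

lemma converges_iff:
  "converges_in_measure \<A> l F f \<longleftrightarrow>
    (\<forall>c>0. \<forall>\<epsilon>>0. \<exists>N. \<forall>n\<ge>N. \<exists>B\<in>\<A>. {w. c < \<bar>F n w - f w\<bar>} \<subseteq> B \<and> l B < \<epsilon>)"
proof -
  have "outer_val \<A> l E < ennreal \<epsilon> \<longleftrightarrow> (\<exists>B\<in>\<A>. E \<subseteq> B \<and> l B < \<epsilon>)" for E \<epsilon>
    using nonneg by (auto simp: outer_val_def INF_less_iff ennreal_less_iff)
  then show ?thesis
    unfolding converges_in_measure_def ennreal_tendsto_0_iff by simp
qed

lemma approximatingD:
  assumes "approximating \<A> l f F"
  shows "F n \<in> simple_functions \<A>"
    and "\<lbrakk>0 < c; 0 < \<epsilon>\<rbrakk> \<Longrightarrow> \<exists>N. \<forall>n\<ge>N. \<exists>B\<in>\<A>. {w. c < \<bar>F n w - f w\<bar>} \<subseteq> B \<and> l B < \<epsilon>"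
    and "0 < \<epsilon> \<Longrightarrow> \<exists>N. \<forall>n\<ge>N. \<forall>k\<ge>N. simple_int l (\<lambda>w. \<bar>F n w - F k w\<bar>) < \<epsilon>"
  using assms by (auto simp: approximating_def converges_iff)

lemma simple_abs_diff:
  assumes "f \<in> simple_functions \<A>" "g \<in> simple_functions \<A>"
  shows "(\<lambda>w. \<bar>f w - g w\<bar>) \<in> simple_functions \<A>"
  using simple_binop[OF assms, of "\<lambda>a b. \<bar>a - b\<bar>"] by simp

text \<open>One statement for sums, differences, multiples, lattice operations and truncations: all
  are Lipschitz and fix 0, the latter keeping the approximants simple.\<close>

lemma approximating_binop:
  assumes F: "approximating \<A> l f F" and G: "approximating \<A> l g G"
    and z: "\<phi> 0 0 = 0" and K: "0 < K"
    and lip: "\<And>a b c d. \<bar>\<phi> a b - \<phi> c d\<bar> \<le> K * (\<bar>a - c\<bar> + \<bar>b - d\<bar>)"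
  shows "approximating \<A> l (\<lambda>w. \<phi> (f w) (g w)) (\<lambda>n w. \<phi> (F n w) (G n w))"
  unfolding approximating_def converges_iff
proof (intro conjI allI impI)
  note sF = approximatingD(1)[OF F] and sG = approximatingD(1)[OF G]
  show "(\<lambda>w. \<phi> (F n w) (G n w)) \<in> simple_functions \<A>" for n
    using simple_binop[OF sF sG, of \<phi>] z by simp
  fix \<epsilon> :: real assume e: "0 < \<epsilon>"
  show "\<exists>N. \<forall>n\<ge>N. \<exists>B\<in>\<A>. {w. c < \<bar>\<phi> (F n w) (G n w) - \<phi> (f w) (g w)\<bar>} \<subseteq> B \<and> l B < \<epsilon>"
    if c: "0 < c" for c
  proof -
    \<comment> \<open>If the composed functions differ by more than \<open>c\<close>, one of the two
      arguments differs by more than \<open>c / (2 * K)\<close>.\<close>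
    have c': "0 < c / (2 * K)" and e': "0 < \<epsilon> / 2" using c K e by auto
    obtain N1 where N1: "\<forall>n\<ge>N1. \<exists>B\<in>\<A>. {w. c / (2 * K) < \<bar>F n w - f w\<bar>} \<subseteq> B \<and> l B < \<epsilon> / 2"
      using approximatingD(2)[OF F c' e'] by blast
    obtain N2 where N2: "\<forall>n\<ge>N2. \<exists>B\<in>\<A>. {w. c / (2 * K) < \<bar>G n w - g w\<bar>} \<subseteq> B \<and> l B < \<epsilon> / 2"
      using approximatingD(2)[OF G c' e'] by blast
    have "\<exists>B\<in>\<A>. {w. c < \<bar>\<phi> (F n w) (G n w) - \<phi> (f w) (g w)\<bar>} \<subseteq> B \<and> l B < \<epsilon>"
      if n: "n \<ge> max N1 N2" for n
    proof -
      obtain B1 where B1: "B1 \<in> \<A>" "{w. c / (2 * K) < \<bar>F n w - f w\<bar>} \<subseteq> B1" "l B1 < \<epsilon> / 2"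
        using N1 n by auto
      obtain B2 where B2: "B2 \<in> \<A>" "{w. c / (2 * K) < \<bar>G n w - g w\<bar>} \<subseteq> B2" "l B2 < \<epsilon> / 2"
        using N2 n by auto
      have "{w. c < \<bar>\<phi> (F n w) (G n w) - \<phi> (f w) (g w)\<bar>} \<subseteq> B1 \<union> B2"
      proof
        fix w assume "w \<in> {w. c < \<bar>\<phi> (F n w) (G n w) - \<phi> (f w) (g w)\<bar>}"
        then have "c < K * (\<bar>F n w - f w\<bar> + \<bar>G n w - g w\<bar>)"
          using lip[of "F n w" "G n w" "f w" "g w"] by simp
        then have "c / K < \<bar>F n w - f w\<bar> + \<bar>G n w - g w\<bar>"
          using K by (simp add: field_simps)
        then have "c / (2 * K) < \<bar>F n w - f w\<bar> \<or> c / (2 * K) < \<bar>G n w - g w\<bar>"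
          by (simp add: field_simps) linarith
        then show "w \<in> B1 \<union> B2" using B1 B2 by blast
      qed
      then show ?thesis
        using subadditive_l[OF B1(1) B2(1)] B1 B2 by (intro bexI[of _ "B1 \<union> B2"]) auto
    qed
    then show ?thesis by blast
  qed
  have e': "0 < \<epsilon> / (2 * K)" using e K by simp
  obtain N1 where N1: "\<forall>n\<ge>N1. \<forall>k\<ge>N1. simple_int l (\<lambda>w. \<bar>F n w - F k w\<bar>) < \<epsilon> / (2 * K)"
    using approximatingD(3)[OF F e'] by blast
  obtain N2 where N2: "\<forall>n\<ge>N2. \<forall>k\<ge>N2. simple_int l (\<lambda>w. \<bar>G n w - G k w\<bar>) < \<epsilon> / (2 * K)"
    using approximatingD(3)[OF G e'] by blast
  have "simple_int l (\<lambda>w. \<bar>\<phi> (F n w) (G n w) - \<phi> (F k w) (G k w)\<bar>) < \<epsilon>"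
    if nk: "n \<ge> max N1 N2" "k \<ge> max N1 N2" for n k
  proof -
    note d1 = simple_abs_diff[OF sF[of n] sF[of k]]
    note d2 = simple_abs_diff[OF sG[of n] sG[of k]]
    have d3: "(\<lambda>w. \<bar>F n w - F k w\<bar> + \<bar>G n w - G k w\<bar>) \<in> simple_functions \<A>"
      using simple_binop[OF d1 d2, of "(+)"] by simp
    have "simple_int l (\<lambda>w. \<bar>\<phi> (F n w) (G n w) - \<phi> (F k w) (G k w)\<bar>)
        \<le> simple_int l (\<lambda>w. K * (\<bar>F n w - F k w\<bar> + \<bar>G n w - G k w\<bar>))"
    proof (rule simple_int_mono)
      show "(\<lambda>w. \<bar>\<phi> (F n w) (G n w) - \<phi> (F k w) (G k w)\<bar>) \<in> simple_functions \<A>"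
        using simple_abs_diff[OF simple_binop[OF sF sG, of \<phi>] simple_binop[OF sF sG, of \<phi>]] z
        by simp
      show "(\<lambda>w. K * (\<bar>F n w - F k w\<bar> + \<bar>G n w - G k w\<bar>)) \<in> simple_functions \<A>"
        using simple_unop[OF d3, of "(*) K"] by simp
    qed (rule lip)
    also have "\<dots> = K * (simple_int l (\<lambda>w. \<bar>F n w - F k w\<bar>) + simple_int l (\<lambda>w. \<bar>G n w - G k w\<bar>))"
      using simple_int_cmult[OF d3] simple_int_add[OF d1 d2] by simp
    also have "\<dots> < K * (\<epsilon> / (2 * K) + \<epsilon> / (2 * K))"
      using N1 N2 nk K by (intro mult_strict_left_mono add_strict_mono) auto
    also have "\<dots> = \<epsilon>" using K by (simp add: field_simps)
    finally show ?thesis .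
  qed
  then show "\<exists>N. \<forall>n\<ge>N. \<forall>k\<ge>N. simple_int l (\<lambda>w. \<bar>\<phi> (F n w) (G n w) - \<phi> (F k w) (G k w)\<bar>) < \<epsilon>"
    by blast
qed

lemma approximating_add:
  assumes "approximating \<A> l f F" "approximating \<A> l g G"
  shows "approximating \<A> l (\<lambda>w. f w + g w) (\<lambda>n w. F n w + G n w)"
  using approximating_binop[OF assms, of "(+)" 1] by (simp add: abs_if)

lemma approximating_diff:
  assumes "approximating \<A> l f F" "approximating \<A> l g G"
  shows "approximating \<A> l (\<lambda>w. f w - g w) (\<lambda>n w. F n w - G n w)"
  using approximating_binop[OF assms, of "(-)" 1] by (simp add: abs_if)

lemma approximating_lipschitz:
  assumes "approximating \<A> l f F" "\<phi> 0 = 0" "0 < K" "\<And>a b. \<bar>\<phi> a - \<phi> b\<bar> \<le> K * \<bar>a - b\<bar>"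
  shows "approximating \<A> l (\<lambda>w. \<phi> (f w)) (\<lambda>n w. \<phi> (F n w))"
proof (rule approximating_binop[OF assms(1,1), of "\<lambda>a b. \<phi> a"])
  fix a b c d :: real
  have "K * \<bar>a - c\<bar> \<le> K * (\<bar>a - c\<bar> + \<bar>b - d\<bar>)"
    using assms(3) by (intro mult_left_mono) auto
  with assms(4)[of a c] show "\<bar>\<phi> a - \<phi> c\<bar> \<le> K * (\<bar>a - c\<bar> + \<bar>b - d\<bar>)" by linarith
qed (use assms in auto)

lemma approximating_cmult:
  assumes "approximating \<A> l f F"
  shows "approximating \<A> l (\<lambda>w. c * f w) (\<lambda>n w. c * F n w)"
proof (rule approximating_lipschitz[OF assms])
  \<comment> \<open>The added 1 keeps the Lipschitz constant positive when \<open>c\<close> is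
    0.\<close>
  show "\<bar>c * a - c * b\<bar> \<le> (\<bar>c\<bar> + 1) * \<bar>a - b\<bar>" for a b
  proof -
    have "\<bar>c * a - c * b\<bar> = \<bar>c\<bar> * \<bar>a - b\<bar>"
      by (simp add: abs_mult flip: right_diff_distrib)
    then show ?thesis by (simp add: distrib_right)
  qed
qed auto

lemma approximating_const:
  assumes "f \<in> simple_functions \<A>"
  shows "approximating \<A> l f (\<lambda>n. f)"
  unfolding approximating_def converges_iff using assms by (auto intro!: exI[of _ 0] bexI[of _ "{}"])

text \<open>Off the support of a late \<open>F N\<close> the Cauchy property controls \<open>F n\<close>; on this set of finite
  content convergence in measure does.\<close>

lemma approximating_0_tendsto:
  assumes F: "approximating \<A> l (\<lambda>w. 0) F"
  shows "(\<lambda>n. simple_int l (\<lambda>w. \<bar>F n w\<bar>)) \<longlonglongrightarrow> 0"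
proof (rule LIMSEQ_I)
  fix r :: real assume r: "0 < r"
  note sF = approximatingD(1)[OF F]
  obtain N where N: "\<forall>n\<ge>N. \<forall>k\<ge>N. simple_int l (\<lambda>w. \<bar>F n w - F k w\<bar>) < r / 3"
    using approximatingD(3)[OF F, of "r / 3"] r by auto
  define A where "A = {w. F N w \<noteq> 0}"
  have A: "A \<in> \<A>" using simple_support[OF sF] by (simp add: A_def)
  \<comment> \<open>On the exceptional set \<open>B\<close> the bound \<open>M\<close> on
    \<open>F N\<close> gives \<bar>F n\<bar> \<le> \<bar>F n - F N\<bar> + M, so no bound on
    \<open>F n\<close> uniform in \<open>n\<close> is required.\<close>
  obtain M where M: "0 < M" "\<And>w. \<bar>F N w\<bar> \<le> M" using simple_bounded[OF sF] by blast
  \<comment> \<open>Makes the contribution \<open>c * l A\<close> of the points of \<open>A\<close>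
    outside \<open>B\<close> at most \<open>r / 3\<close>; the added 1 covers
    \<open>l A = 0\<close>.\<close>
  define c where "c = r / (3 * (l A + 1))"
  have lA: "0 \<le> l A" using nonneg A by blast
  then have c: "0 < c" using r by (simp add: c_def)
  have "c * l A \<le> r / 3"
    using lA r by (simp add: c_def field_simps)
  obtain N2 where N2: "\<forall>n\<ge>N2. \<exists>B\<in>\<A>. {w. c < \<bar>F n w - 0\<bar>} \<subseteq> B \<and> l B < r / (3 * M)"
    using approximatingD(2)[OF F c, of "r / (3 * M)"] r M by auto
  have "simple_int l (\<lambda>w. \<bar>F n w\<bar>) < r" if n: "n \<ge> max N N2" for n
  proof -
    obtain B where B: "B \<in> \<A>" "{w. c < \<bar>F n w\<bar>} \<subseteq> B" "l B < r / (3 * M)"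
      using N2 n by auto
    note d = simple_abs_diff[OF sF[of n] sF[of N]]
    have sA: "(\<lambda>w. c * indicat_real A w) \<in> simple_functions \<A>"
      and sB: "(\<lambda>w. M * indicat_real B w) \<in> simple_functions \<A>"
      using levels_indicator A B by (auto simp: simple_iff_levels)
    have sAB: "(\<lambda>w. c * indicat_real A w + M * indicat_real B w) \<in> simple_functions \<A>"
      using simple_binop[OF sA sB, of "(+)"] by simp
    have "simple_int l (\<lambda>w. \<bar>F n w\<bar>) \<le>
        simple_int l (\<lambda>w. \<bar>F n w - F N w\<bar> + (c * indicat_real A w + M * indicat_real B w))"
    proof (rule simple_int_mono)
      show "(\<lambda>w. \<bar>F n w\<bar>) \<in> simple_functions \<A>" using simple_unop[OF sF, of abs] by simp
      show "(\<lambda>w. \<bar>F n w - F N w\<bar> + (c * indicat_real A w + M * indicat_real B w)) \<in> simple_functions \<A>"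
        using simple_binop[OF d sAB, of "(+)"] by simp
      fix w
      have "F N w = 0" if "w \<notin> A" using that by (simp add: A_def)
      moreover have "\<bar>F n w\<bar> \<le> c" if "w \<notin> B" using that B by force
      ultimately show "\<bar>F n w\<bar> \<le> \<bar>F n w - F N w\<bar> + (c * indicat_real A w + M * indicat_real B w)"
        using M(2)[of w] c M(1) by (auto simp: indicator_def)
    qed
    also have "\<dots> = simple_int l (\<lambda>w. \<bar>F n w - F N w\<bar>) + (c * l A + M * l B)"
      using simple_int_add[OF d sAB] simple_int_add[OF sA sB]
        simple_int_cmult[OF simple_indicator[OF A]] simple_int_cmult[OF simple_indicator[OF B(1)]]
        simple_int_indicator[OF A] simple_int_indicator[OF B(1)] by simp
    also have "\<dots> < r / 3 + (r / 3 + r / 3)"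
    proof -
      have "M * l B < r / 3" using B(3) M(1) by (simp add: field_simps)
      then show ?thesis using N n \<open>c * l A \<le> r / 3\<close> by (intro add_strict_mono add_le_less_mono) auto
    qed
    finally show ?thesis by simp
  qed
  moreover have "0 \<le> simple_int l (\<lambda>w. \<bar>F n w\<bar>)" for n
    using simple_unop[OF sF, of abs] by (intro simple_int_nonneg) auto
  ultimately show "\<exists>no. \<forall>n\<ge>no. norm (simple_int l (\<lambda>w. \<bar>F n w\<bar>) - 0) < r"
    by (intro exI[of _ "max N N2"]) auto
qed

text \<open>The difference of the sequences approximates 0, so its integrals tend to 0 in absolute
  value. This is what makes \<open>fa_integral\<close> well defined.\<close>

lemma approximating_unique:
  assumes F: "approximating \<A> l f F" and G: "approximating \<A> l f G"
  shows "(\<lambda>n. simple_int l (F n) - simple_int l (G n)) \<longlonglongrightarrow> 0"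
proof (rule Lim_null_comparison)
  note sF = approximatingD(1)[OF F] and sG = approximatingD(1)[OF G]
  show "(\<lambda>n. simple_int l (\<lambda>w. \<bar>F n w - G n w\<bar>)) \<longlonglongrightarrow> 0"
    using approximating_0_tendsto approximating_diff[OF F G] by simp
  show "\<forall>\<^sub>F n in sequentially. norm (simple_int l (F n) - simple_int l (G n))
      \<le> simple_int l (\<lambda>w. \<bar>F n w - G n w\<bar>)"
    using abs_simple_int_le[OF simple_binop[OF sF sG, of "(-)"]] simple_int_diff[OF sF sG]
    by (intro always_eventually) simp
qed

lemma approximating_convergent:
  assumes F: "approximating \<A> l f F"
  shows "convergent (\<lambda>n. simple_int l (F n))"
proof (rule Cauchy_convergent, rule CauchyI)
  note sF = approximatingD(1)[OF F]
  fix e :: real assume "0 < e"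
  then obtain N where N: "\<forall>n\<ge>N. \<forall>k\<ge>N. simple_int l (\<lambda>w. \<bar>F n w - F k w\<bar>) < e"
    using approximatingD(3)[OF F] by blast
  have "\<bar>simple_int l (F n) - simple_int l (F k)\<bar> \<le> simple_int l (\<lambda>w. \<bar>F n w - F k w\<bar>)" for n k
    using abs_simple_int_le[OF simple_binop[OF sF sF, of "(-)"]] simple_int_diff[OF sF sF] by simp
  with N show "\<exists>M. \<forall>m\<ge>M. \<forall>n\<ge>M. norm (simple_int l (F m) - simple_int l (F n)) < e"
    unfolding real_norm_def by (meson le_less_trans)
qed

lemma approximating_integral:
  assumes F: "approximating \<A> l f F"
  shows "(\<lambda>n. simple_int l (F n)) \<longlonglongrightarrow> fa_integral \<A> l f"
proof -
  obtain I where I: "(\<lambda>n. simple_int l (F n)) \<longlonglongrightarrow> I"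
    using approximating_convergent[OF F] by (auto simp: convergent_def)
  have "fa_integral \<A> l f = I"
    unfolding fa_integral_def
  proof (rule the_equality)
    show "\<exists>F. approximating \<A> l f F \<and> (\<lambda>n. simple_int l (F n)) \<longlonglongrightarrow> I" using F I by blast
    fix J assume "\<exists>G. approximating \<A> l f G \<and> (\<lambda>n. simple_int l (G n)) \<longlonglongrightarrow> J"
    then obtain G where G: "approximating \<A> l f G" "(\<lambda>n. simple_int l (G n)) \<longlonglongrightarrow> J" by blast
    have "I - J = 0"
      using LIMSEQ_unique[OF tendsto_diff[OF I G(2)] approximating_unique[OF F G(1)]] .
    then show "J = I" by simp
  qed
  with I show ?thesis by simp
qed

section \<open>The integrable functions as a vector lattice with a positive linear integral\<close>

lemma L1I: "approximating \<A> l f F \<Longrightarrow> f \<in> L1 \<A> l"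
  by (auto simp: L1_def)

lemma simple_L1: "f \<in> simple_functions \<A> \<Longrightarrow> f \<in> L1 \<A> l"
  using approximating_const L1I by blast

lemma integral_simple: "f \<in> simple_functions \<A> \<Longrightarrow> fa_integral \<A> l f = simple_int l f"
  using approximating_integral[OF approximating_const] LIMSEQ_unique tendsto_const by blast

lemma L1_binop:
  assumes "f \<in> L1 \<A> l" "g \<in> L1 \<A> l" "\<phi> 0 0 = 0" "0 < K"
    and "\<And>a b c d. \<bar>\<phi> a b - \<phi> c d\<bar> \<le> K * (\<bar>a - c\<bar> + \<bar>b - d\<bar>)"
  shows "(\<lambda>w. \<phi> (f w) (g w)) \<in> L1 \<A> l"
  using approximating_binop[of f _ g, OF _ _ assms(3-5)] assms(1,2) unfolding L1_def by blast

lemma L1_add: "\<lbrakk>f \<in> L1 \<A> l; g \<in> L1 \<A> l\<rbrakk> \<Longrightarrow> (\<lambda>w. f w + g w) \<in> L1 \<A> l"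
  and integral_add: "\<lbrakk>f \<in> L1 \<A> l; g \<in> L1 \<A> l\<rbrakk> \<Longrightarrow>
    fa_integral \<A> l (\<lambda>w. f w + g w) = fa_integral \<A> l f + fa_integral \<A> l g"
proof -
  assume "f \<in> L1 \<A> l" "g \<in> L1 \<A> l"
  then obtain F G where F: "approximating \<A> l f F" and G: "approximating \<A> l g G"
    by (auto simp: L1_def)
  note FG = approximating_add[OF F G]
  then show "(\<lambda>w. f w + g w) \<in> L1 \<A> l" by (rule L1I)
  have "(\<lambda>n. simple_int l (F n) + simple_int l (G n)) \<longlonglongrightarrow> fa_integral \<A> l (\<lambda>w. f w + g w)"
    using approximating_integral[OF FG] simple_int_add[OF approximatingD(1)[OF F] approximatingD(1)[OF G]]
    by simp
  then show "fa_integral \<A> l (\<lambda>w. f w + g w) = fa_integral \<A> l f + fa_integral \<A> l g"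
    using tendsto_add[OF approximating_integral[OF F] approximating_integral[OF G]] LIMSEQ_unique
    by blast
qed

lemma L1_cmult: "f \<in> L1 \<A> l \<Longrightarrow> (\<lambda>w. c * f w) \<in> L1 \<A> l"
  and integral_cmult: "f \<in> L1 \<A> l \<Longrightarrow> fa_integral \<A> l (\<lambda>w. c * f w) = c * fa_integral \<A> l f"
proof -
  assume "f \<in> L1 \<A> l"
  then obtain F where F: "approximating \<A> l f F" by (auto simp: L1_def)
  then show "(\<lambda>w. c * f w) \<in> L1 \<A> l" using approximating_cmult L1I by blast
  have "(\<lambda>n. c * simple_int l (F n)) \<longlonglongrightarrow> fa_integral \<A> l (\<lambda>w. c * f w)"
    using approximating_integral[OF approximating_cmult[OF F, of c]]
      simple_int_cmult[OF approximatingD(1)[OF F]] by simp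
  then show "fa_integral \<A> l (\<lambda>w. c * f w) = c * fa_integral \<A> l f"
    using tendsto_mult_left[OF approximating_integral[OF F]] LIMSEQ_unique by blast
qed

lemma L1_diff: "\<lbrakk>f \<in> L1 \<A> l; g \<in> L1 \<A> l\<rbrakk> \<Longrightarrow> (\<lambda>w. f w - g w) \<in> L1 \<A> l"
  and integral_diff: "\<lbrakk>f \<in> L1 \<A> l; g \<in> L1 \<A> l\<rbrakk> \<Longrightarrow>
    fa_integral \<A> l (\<lambda>w. f w - g w) = fa_integral \<A> l f - fa_integral \<A> l g"
  using L1_add[OF _ L1_cmult[of g "- 1"], of f] integral_add[OF _ L1_cmult[of g "- 1"], of f]
    integral_cmult[of g "- 1"] by auto

lemma L1_max: "\<lbrakk>f \<in> L1 \<A> l; g \<in> L1 \<A> l\<rbrakk> \<Longrightarrow> (\<lambda>w. max (f w) (g w)) \<in> L1 \<A> l"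
  by (rule L1_binop[where K = 1]) (auto simp: max_def)

lemma L1_min: "\<lbrakk>f \<in> L1 \<A> l; g \<in> L1 \<A> l\<rbrakk> \<Longrightarrow> (\<lambda>w. min (f w) (g w)) \<in> L1 \<A> l"
  by (rule L1_binop[where K = 1]) (auto simp: min_def)

lemma L1_abs: "f \<in> L1 \<A> l \<Longrightarrow> (\<lambda>w. \<bar>f w\<bar>) \<in> L1 \<A> l"
  by (rule L1_binop[where K = 1 and \<phi> = "\<lambda>a b. \<bar>a\<bar>"]) auto

lemma L1_min_const: "\<lbrakk>f \<in> L1 \<A> l; 0 \<le> c\<rbrakk> \<Longrightarrow> (\<lambda>w. min (f w) c) \<in> L1 \<A> l"
  by (rule L1_binop[where K = 1 and \<phi> = "\<lambda>a b. min a c"]) (auto simp: min_def)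

lemma approximating_nonneg:
  assumes "f \<in> L1 \<A> l" "\<And>w. 0 \<le> f w"
  obtains F where "approximating \<A> l f F" "\<And>n w. 0 \<le> F n w"
proof -
  obtain F where F: "approximating \<A> l f F" using assms by (auto simp: L1_def)
  have "approximating \<A> l (\<lambda>w. max (f w) 0) (\<lambda>n w. max (F n w) 0)"
    by (rule approximating_lipschitz[OF F, where K = 1 and \<phi> = "\<lambda>a. max a 0"]) auto
  then show ?thesis using that[of "\<lambda>n w. max (F n w) 0"] assms(2) by (simp add: max_absorb1)
qed

lemma integral_nonneg:
  assumes "f \<in> L1 \<A> l" "\<And>w. 0 \<le> f w"
  shows "0 \<le> fa_integral \<A> l f"
proof -
  obtain F where F: "approximating \<A> l f F" "\<And>n w. 0 \<le> F n w"
    using approximating_nonneg[OF assms] by blast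
  show ?thesis
    using simple_int_nonneg[OF approximatingD(1)[OF F(1)] F(2)]
    by (intro LIMSEQ_le_const[OF approximating_integral[OF F(1)]]) auto
qed

lemma integral_mono:
  assumes "f \<in> L1 \<A> l" "g \<in> L1 \<A> l" "\<And>w. f w \<le> g w"
  shows "fa_integral \<A> l f \<le> fa_integral \<A> l g"
  using integral_nonneg[OF L1_diff[OF assms(2,1)]] integral_diff[OF assms(2,1)] assms(3) by simp

section \<open>Approximation by simple functions and truncation\<close>

lemma L1_abs_diff_simple: "\<lbrakk>f \<in> L1 \<A> l; s \<in> simple_functions \<A>\<rbrakk> \<Longrightarrow> (\<lambda>w. \<bar>f w - s w\<bar>) \<in> L1 \<A> l"
  using L1_abs[OF L1_diff[OF _ simple_L1]] by simp

text \<open>Density of simple functions in mean: for fixed \<open>N\<close> the functions \<bar>F n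
  - F N\<bar> approximate \<bar>f - F N\<bar>, so the Cauchy bound survives in the limit.\<close>

lemma simple_approx:
  assumes f: "f \<in> L1 \<A> l" and e: "0 < \<epsilon>"
  obtains s where "s \<in> simple_functions \<A>" "fa_integral \<A> l (\<lambda>w. \<bar>f w - s w\<bar>) < \<epsilon>"
proof -
  obtain F where F: "approximating \<A> l f F" using f by (auto simp: L1_def)
  obtain N where N: "\<forall>n\<ge>N. \<forall>k\<ge>N. simple_int l (\<lambda>w. \<bar>F n w - F k w\<bar>) < \<epsilon> / 2"
    using approximatingD(3)[OF F, of "\<epsilon> / 2"] e by auto
  note s = approximatingD(1)[OF F, of N]
  have "approximating \<A> l (\<lambda>w. \<bar>f w - F N w\<bar>) (\<lambda>n w. \<bar>F n w - F N w\<bar>)"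
    by (rule approximating_lipschitz[OF approximating_diff[OF F approximating_const[OF s]],
          where K = 1]) auto
  from LIMSEQ_le_const2[OF approximating_integral[OF this], of "\<epsilon> / 2"] N
  have "fa_integral \<A> l (\<lambda>w. \<bar>f w - F N w\<bar>) \<le> \<epsilon> / 2" by (auto intro: less_imp_le)
  then show ?thesis using that[OF s] e by simp
qed

lemma integral_abs_diff_le:
  assumes "f \<in> L1 \<A> l" "g \<in> L1 \<A> l"
  shows "\<bar>fa_integral \<A> l f - fa_integral \<A> l g\<bar> \<le> fa_integral \<A> l (\<lambda>w. \<bar>f w - g w\<bar>)"
proof -
  note d = L1_diff[OF assms] L1_diff[OF assms(2,1)]
  have "fa_integral \<A> l (\<lambda>w. f w - g w) \<le> fa_integral \<A> l (\<lambda>w. \<bar>f w - g w\<bar>)"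
    "fa_integral \<A> l (\<lambda>w. g w - f w) \<le> fa_integral \<A> l (\<lambda>w. \<bar>f w - g w\<bar>)"
    using d L1_abs[OF d(1)] by (auto intro!: integral_mono)
  then show ?thesis using integral_diff[OF assms] integral_diff[OF assms(2,1)] by linarith
qed

text \<open>Clipping to the interval from 0 to \<open>K\<close> is a contraction that leaves
  \<open>f\<close> fixed, so it can only improve the approximation.\<close>

lemma simple_approx_bounded:
  assumes f: "f \<in> L1 \<A> l" and e: "0 < \<epsilon>" and f0: "\<And>w. 0 \<le> f w" and fK: "\<And>w. f w \<le> K"
  obtains s where "s \<in> simple_functions \<A>" "fa_integral \<A> l (\<lambda>w. \<bar>f w - s w\<bar>) < \<epsilon>"
    "\<And>w. 0 \<le> s w" "\<And>w. s w \<le> K"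
proof -
  obtain s where s: "s \<in> simple_functions \<A>" "fa_integral \<A> l (\<lambda>w. \<bar>f w - s w\<bar>) < \<epsilon>"
    using simple_approx[OF f e] by blast
  have K: "0 \<le> K" using f0 fK by (meson order_trans)
  define t where "t = (\<lambda>w. min (max (s w) 0) K)"
  have t: "t \<in> simple_functions \<A>"
    using simple_unop[OF s(1), of "\<lambda>a. min (max a 0) K"] K by (simp add: t_def)
  have "fa_integral \<A> l (\<lambda>w. \<bar>f w - t w\<bar>) \<le> fa_integral \<A> l (\<lambda>w. \<bar>f w - s w\<bar>)"
  proof (rule integral_mono)
    show "\<bar>f w - t w\<bar> \<le> \<bar>f w - s w\<bar>" for w
      using f0[of w] fK[of w] by (auto simp: t_def min_def max_def)
  qed (use f s(1) t in \<open>auto intro!: L1_abs_diff_simple\<close>)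
  with s t K show ?thesis using that[of t] by (auto simp: t_def)
qed

text \<open>A substitute for dominated convergence as the cut-off tends to 0. A simple
  \<open>s\<close> near \<open>f\<close> has support \<open>A\<close> of finite content, and off
  \<open>A\<close> the whole of \<open>f\<close> is approximation error; hence f \<and> \<delta> is
  at most \<bar>f - s\<bar> plus \<delta> times the indicator of \<open>A\<close>.\<close>

lemma integral_truncate_small:
  assumes f: "f \<in> L1 \<A> l" and f0: "\<And>w. 0 \<le> f w" and e: "0 < \<epsilon>"
  obtains \<delta> where "0 < \<delta>" "fa_integral \<A> l (\<lambda>w. min (f w) \<delta>) < \<epsilon>"
proof -
  obtain s where s: "s \<in> simple_functions \<A>" "fa_integral \<A> l (\<lambda>w. \<bar>f w - s w\<bar>) < \<epsilon> / 2"
    using simple_approx[OF f, of "\<epsilon> / 2"] e by auto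
  define A where "A = {w. s w \<noteq> 0}"
  have A: "A \<in> \<A>" using simple_support[OF s(1)] by (simp add: A_def)
  have lA: "0 \<le> l A" using A nonneg by blast
  define \<delta> where "\<delta> = \<epsilon> / (2 * (l A + 1))"
  have d: "0 < \<delta>" using e lA by (simp add: \<delta>_def)
  have sA: "(\<lambda>w. \<delta> * indicat_real A w) \<in> simple_functions \<A>"
    using levels_indicator A by (auto simp: simple_iff_levels)
  have fs: "(\<lambda>w. \<bar>f w - s w\<bar>) \<in> L1 \<A> l" using f s(1) by (rule L1_abs_diff_simple)
  have "fa_integral \<A> l (\<lambda>w. min (f w) \<delta>) \<le> fa_integral \<A> l (\<lambda>w. \<bar>f w - s w\<bar> + \<delta> * indicat_real A w)"
    using f d fs f0 by (intro integral_mono L1_min_const L1_add simple_L1[OF sA])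
      (auto simp: A_def indicator_def min_def)
  also have "\<dots> = fa_integral \<A> l (\<lambda>w. \<bar>f w - s w\<bar>) + \<delta> * l A"
    using integral_add[OF fs simple_L1[OF sA]] integral_simple[OF sA]
      simple_int_cmult[OF simple_indicator[OF A]] simple_int_indicator[OF A] by simp
  also have "\<dots> < \<epsilon> / 2 + \<epsilon> / 2"
  proof (rule add_less_le_mono[OF s(2)])
    show "\<delta> * l A \<le> \<epsilon> / 2" using lA e by (simp add: \<delta>_def field_simps)
  qed
  finally show ?thesis using that d by simp
qed

text \<open>A simple \<open>s\<close> near \<open>f\<close> is bounded by some \<open>M\<close>, so
  the part of \<open>f\<close> above \<open>M\<close> is dominated by \<bar>f - s\<bar>.\<close>

lemma integral_truncate_large:
  assumes f: "f \<in> L1 \<A> l" and f0: "\<And>w. 0 \<le> f w" and e: "0 < \<epsilon>"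
  obtains M where "0 < M" "fa_integral \<A> l f - fa_integral \<A> l (\<lambda>w. min (f w) M) < \<epsilon>"
proof -
  obtain s where s: "s \<in> simple_functions \<A>" "fa_integral \<A> l (\<lambda>w. \<bar>f w - s w\<bar>) < \<epsilon>"
    using simple_approx[OF f e] by blast
  obtain M where M: "0 < M" "\<And>w. \<bar>s w\<bar> \<le> M" using simple_bounded[OF s(1)] by blast
  have m: "(\<lambda>w. min (f w) M) \<in> L1 \<A> l" using L1_min_const[OF f] M by simp
  have "fa_integral \<A> l (\<lambda>w. f w - min (f w) M) \<le> fa_integral \<A> l (\<lambda>w. \<bar>f w - s w\<bar>)"
  proof (rule integral_mono)
    show "f w - min (f w) M \<le> \<bar>f w - s w\<bar>" for w
      using M(2)[of w] by (auto simp: min_def)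
  qed (use f m s(1) in \<open>auto intro!: L1_abs_diff_simple L1_diff\<close>)
  then show ?thesis using that[OF M(1)] s(2) integral_diff[OF f m] by simp
qed


section \<open>Chebyshev inequalities and the completion\<close>

text \<open>Chebyshev's upper estimate. The set where \<open>f\<close> is at least 1 need not lie in
  the ring, so it is covered by a level set \<open>D\<close> of a late approximant, at the slightly
  lower level \<open>1 - c\<close>, and the set \<open>B\<close> where the approximation is
  poor.\<close>

lemma outer_approx:
  assumes f: "f \<in> L1 \<A> l" and f0: "\<And>w. 0 \<le> f w" and E: "\<And>w. w \<in> E \<Longrightarrow> 1 \<le> f w" and e: "0 < \<epsilon>"
  obtains B where "B \<in> \<A>" "E \<subseteq> B" "l B < fa_integral \<A> l f + \<epsilon>"
proof -
  obtain F where F: "approximating \<A> l f F" and F0: "\<And>n w. 0 \<le> F n w"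
    using approximating_nonneg[OF f f0] by blast
  define I where "I = fa_integral \<A> l f"
  have I0: "0 \<le> I" using integral_nonneg[OF f f0] by (simp add: I_def)
  \<comment> \<open>Dividing by \<open>1 - c\<close> must cost less than the available slack; this
    \<open>c\<close> keeps the loss \<open>c * (I + \<epsilon>)\<close> at \<epsilon> / 4.\<close>
  define c where "c = \<epsilon> / (4 * (I + \<epsilon>))"
  have c: "0 < c" "c < 1" "c * (I + \<epsilon>) = \<epsilon> / 4" using I0 e by (auto simp: c_def field_simps)
  obtain N1 where N1: "\<forall>n\<ge>N1. \<exists>B\<in>\<A>. {w. c < \<bar>F n w - f w\<bar>} \<subseteq> B \<and> l B < \<epsilon> / 4"
    using approximatingD(2)[OF F c(1), of "\<epsilon> / 4"] e by auto
  have "\<forall>\<^sub>F n in sequentially. simple_int l (F n) < I + \<epsilon> / 4"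
    using order_tendstoD(2)[OF approximating_integral[OF F], of "I + \<epsilon> / 4"] e by (simp add: I_def)
  then obtain N2 where N2: "\<forall>n\<ge>N2. simple_int l (F n) < I + \<epsilon> / 4"
    by (auto simp: eventually_sequentially)
  define n where "n = max N1 N2"
  obtain B where B: "B \<in> \<A>" "{w. c < \<bar>F n w - f w\<bar>} \<subseteq> B" "l B < \<epsilon> / 4"
    using N1[rule_format, of n] by (auto simp: n_def)
  define D where "D = {w. 1 - c \<le> F n w}"
  define s where "s = (\<lambda>w. if 1 - c \<le> F n w then 1 else 0 :: real)"
  have s: "s \<in> simple_functions \<A>"
    using simple_unop[OF approximatingD(1)[OF F], of "\<lambda>y. if 1 - c \<le> y then 1 else 0"] c
    by (simp add: s_def)
  have sD: "s = indicat_real D"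
    by (auto simp: s_def D_def indicator_def)
  have D: "D \<in> \<A>"
  proof -
    have "{w. s w \<noteq> 0} = D" by (simp add: sD indicator_def)
    then show ?thesis using simple_support[OF s] by simp
  qed
  have "(1 - c) * l D = simple_int l (\<lambda>w. (1 - c) * s w)"
    using simple_int_cmult[OF s] simple_int_indicator[OF D] by (simp add: sD)
  also have "\<dots> \<le> simple_int l (F n)"
  proof (rule simple_int_mono)
    show "(\<lambda>w. (1 - c) * s w) \<in> simple_functions \<A>" using simple_unop[OF s, of "(*) (1 - c)"] by simp
    show "(1 - c) * s w \<le> F n w" for w using F0[of n w] by (auto simp: s_def)
  qed (rule approximatingD(1)[OF F])
  also have "\<dots> < I + \<epsilon> / 4" using N2 by (simp add: n_def)
  also have "\<dots> \<le> (1 - c) * (I + 3 * \<epsilon> / 4)"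
  proof -
    have "c * (I + 3 * \<epsilon> / 4) \<le> c * (I + \<epsilon>)" using c e by (intro mult_left_mono) auto
    moreover have "(1 - c) * (I + 3 * \<epsilon> / 4) = I + 3 * \<epsilon> / 4 - c * (I + 3 * \<epsilon> / 4)"
      using left_diff_distrib[of 1 c "I + 3 * \<epsilon> / 4"] by (simp only: mult_1)
    ultimately show ?thesis using c(3) e by linarith
  qed
  finally have lD: "l D < I + 3 * \<epsilon> / 4" using c by simp
  have "E \<subseteq> D \<union> B"
  proof
    fix w assume "w \<in> E"
    then have "1 \<le> f w" by (rule E)
    then have "1 - c \<le> F n w" if "w \<notin> B" using that B(2) by force
    then show "w \<in> D \<union> B" by (auto simp: D_def)
  qed
  then show ?thesis
    using that[of "D \<union> B"] subadditive_l[OF D B(1)] D B lD by (auto simp: I_def)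
qed

text \<open>The counterpart of Chebyshev's estimate from inside. The ring set is the place where a
  simple \<open>s\<close> exceeds \<delta>, minus a cover \<open>C\<close> of the points where
  \<open>g\<close> and \<open>s\<close> are \<delta> apart: there \<open>g\<close> cannot vanish.
  What is lost is the part of \<open>g\<close> below \<delta>, small by truncation, the content of
  \<open>C\<close>, and the error in mean.\<close>

lemma inner_approx:
  assumes g: "g \<in> L1 \<A> l" and g0: "\<And>w. 0 \<le> g w" and g1: "\<And>w. g w \<le> 1"
    and E: "\<And>w. w \<notin> E \<Longrightarrow> g w = 0" and e: "0 < \<epsilon>"
  obtains B where "B \<in> \<A>" "B \<subseteq> E" "fa_integral \<A> l g - \<epsilon> < l B"
proof -
  obtain \<delta> where d: "0 < \<delta>" "fa_integral \<A> l (\<lambda>w. min (g w) \<delta>) < \<epsilon> / 4"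
    using integral_truncate_small[OF g g0, of "\<epsilon> / 4"] e by auto
  \<comment> \<open>The first entry limits the error in mean, which is charged twice. The second
    survives the division by \<delta> in the estimate of \<open>l C\<close>.\<close>
  define \<eta> where "\<eta> = min (\<epsilon> / 8) (\<delta> * \<epsilon> / 8)"
  have "0 < \<eta>" "\<eta> \<le> \<epsilon> / 8" "\<eta> \<le> \<delta> * \<epsilon> / 8" using e d by (auto simp: \<eta>_def)
  obtain s where s: "s \<in> simple_functions \<A>" "fa_integral \<A> l (\<lambda>w. \<bar>g w - s w\<bar>) < \<eta>"
    "\<And>w. 0 \<le> s w" "\<And>w. s w \<le> 1"
    using simple_approx_bounded[OF g \<open>0 < \<eta>\<close> g0 g1] by blast
  note gs = L1_abs_diff_simple[OF g s(1)]
  obtain C where C: "C \<in> \<A>" "{w. \<delta> \<le> \<bar>g w - s w\<bar>} \<subseteq> C"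
    "l C < fa_integral \<A> l (\<lambda>w. 1 / \<delta> * \<bar>g w - s w\<bar>) + \<epsilon> / 8"
    using outer_approx[OF L1_cmult[OF gs, of "1 / \<delta>"], of "{w. \<delta> \<le> \<bar>g w - s w\<bar>}" "\<epsilon> / 8"] d e
    by (auto simp: field_simps)
  have "fa_integral \<A> l (\<lambda>w. 1 / \<delta> * \<bar>g w - s w\<bar>) \<le> \<epsilon> / 8"
  proof -
    have "1 / \<delta> * fa_integral \<A> l (\<lambda>w. \<bar>g w - s w\<bar>) \<le> 1 / \<delta> * (\<delta> * \<epsilon> / 8)"
      using s(2) \<open>\<eta> \<le> \<delta> * \<epsilon> / 8\<close> d by (intro mult_left_mono) auto
    then show ?thesis using integral_cmult[OF gs, of "1 / \<delta>"] d by simp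
  qed
  with C have lC: "l C < \<epsilon> / 4" by simp
  define D where "D = {w. \<delta> < s w}"
  have D: "D \<in> \<A>" using simple_level_gt[OF s(1) d(1)] by (simp add: D_def)
  have ms: "(\<lambda>w. min (s w) \<delta>) \<in> simple_functions \<A>"
    using simple_unop[OF s(1), of "\<lambda>y. min y \<delta>"] d by simp
  have mg: "(\<lambda>w. min (g w) \<delta>) \<in> L1 \<A> l" using L1_min_const[OF g] d by simp
  have "fa_integral \<A> l g \<le> fa_integral \<A> l s + \<eta>"
    using integral_abs_diff_le[OF g simple_L1[OF s(1)]] s(2) by linarith
  \<comment> \<open>The bound \<open>s \<le> 1\<close> is used here: the part of \<open>s\<close>
    above \<delta> is paid for by the indicator of \<open>D\<close>.\<close>
  moreover have "fa_integral \<A> l s \<le> fa_integral \<A> l (\<lambda>w. indicat_real D w + min (s w) \<delta>)"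
  proof (intro integral_mono L1_add simple_L1 simple_indicator D ms s(1))
    show "s w \<le> indicat_real D w + min (s w) \<delta>" for w
      using s(4)[of w] d(1) by (simp add: D_def indicator_def min_def)
  qed
  moreover have "\<dots> = l D + fa_integral \<A> l (\<lambda>w. min (s w) \<delta>)"
    using integral_add[OF simple_L1[OF simple_indicator[OF D]] simple_L1[OF ms]]
      integral_simple[OF simple_indicator[OF D]] simple_int_indicator[OF D] by simp
  moreover have "fa_integral \<A> l (\<lambda>w. min (s w) \<delta>) \<le> fa_integral \<A> l (\<lambda>w. min (g w) \<delta> + \<bar>g w - s w\<bar>)"
    using mg gs by (intro integral_mono L1_add simple_L1[OF ms]) (auto simp: min_def)
  moreover have "\<dots> = fa_integral \<A> l (\<lambda>w. min (g w) \<delta>) + fa_integral \<A> l (\<lambda>w. \<bar>g w - s w\<bar>)"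
    by (rule integral_add[OF mg gs])
  moreover have "l D \<le> l (D - C) + l C"
  proof -
    have "D - C \<in> \<A>" using D C(1) by (rule Diff)
    then have "l D \<le> l ((D - C) \<union> C)" using D C(1) by (intro mono_l Un) auto
    also have "\<dots> \<le> l (D - C) + l C" using \<open>D - C \<in> \<A>\<close> C(1) by (rule subadditive_l)
    finally show ?thesis .
  qed
  ultimately have "fa_integral \<A> l g - \<epsilon> < l (D - C)"
    using d s(2) \<open>\<eta> \<le> \<epsilon> / 8\<close> lC e by linarith
  moreover have "D - C \<subseteq> E"
  proof
    fix w assume w: "w \<in> D - C"
    then have "\<bar>g w - s w\<bar> < \<delta>" using C(2) by force
    then have "g w \<noteq> 0" using w by (auto simp: D_def)
    then show "w \<in> E" using E by blast
  qed
  ultimately show ?thesis using that[of "D - C"] Diff[OF D C(1)] by blast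
qed

lemma inner_le_outer: "inner_val \<A> l E \<le> outer_val \<A> l E"
  unfolding inner_val_def outer_val_def
  by (intro SUP_least INF_greatest ennreal_leI mono_l) auto

text \<open>Membership in the completion, in the form in which it is proved and used: a squeeze
  between two ring sets with contents close to a common real value.\<close>

lemma completion_iff:
  "E \<in> completion_ring \<A> l \<and> extension \<A> l E = r \<longleftrightarrow>
    (\<forall>\<epsilon>>0. \<exists>A\<in>\<A>. \<exists>B\<in>\<A>. A \<subseteq> E \<and> E \<subseteq> B \<and> r - \<epsilon> < l A \<and> l B < r + \<epsilon>)"
    (is "?L \<longleftrightarrow> ?R")
proof
  assume ?L
  then have eq: "outer_val \<A> l E = inner_val \<A> l E" and r: "outer_val \<A> l E = ennreal r" "0 \<le> r"
    by (auto simp: completion_ring_def extension_def less_top)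
  show ?R
  proof (intro allI impI)
    fix \<epsilon> :: real assume e: "0 < \<epsilon>"
    have "outer_val \<A> l E < ennreal (r + \<epsilon>)" using r e by (simp add: ennreal_less_iff)
    then obtain B where B: "B \<in> \<A>" "E \<subseteq> B" "l B < r + \<epsilon>" using outer_less by blast
    have "\<exists>A\<in>\<A>. A \<subseteq> E \<and> r - \<epsilon> < l A"
    \<comment> \<open>Conversion to \<open>ennreal\<close> sends negative reals to 0, which would
      make the strict inequality too strong; there the empty set serves.\<close>
    proof (cases "r - \<epsilon> < 0")
      case True
      then have "{} \<in> \<A> \<and> {} \<subseteq> E \<and> r - \<epsilon> < l {}" by simp
      then show ?thesis by blast
    next
      case False
      then have "ennreal (r - \<epsilon>) < inner_val \<A> l E" using r e by (simp add: ennreal_less_iff flip: eq)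
      then show ?thesis using inner_greater[of "r - \<epsilon>" E] False by (metis not_less)
    qed
    with B show "\<exists>A\<in>\<A>. \<exists>B\<in>\<A>. A \<subseteq> E \<and> E \<subseteq> B \<and> r - \<epsilon> < l A \<and> l B < r + \<epsilon>" by blast
  qed
next
  assume R: ?R
  have r: "0 \<le> r"
  proof (rule field_le_epsilon)
    fix e :: real assume "0 < e"
    with R obtain B where "B \<in> \<A>" "l B < r + e" by blast
    then show "0 \<le> r + e" using nonneg[of B] by linarith
  qed
  have "outer_val \<A> l E \<le> ennreal r"
  proof (rule ennreal_le_epsilon)
    fix e :: real assume e: "0 < e"
    with R obtain B where "B \<in> \<A>" "E \<subseteq> B" "l B < r + e" by blast
    then show "outer_val \<A> l E \<le> ennreal r + ennreal e"
      using outer_le[of B E] r e by (metis ennreal_leI ennreal_plus less_imp_le order_trans)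
  qed
  moreover have "ennreal r \<le> inner_val \<A> l E"
  proof (rule ennreal_le_epsilon)
    fix e :: real assume e: "0 < e"
    with R obtain A where A: "A \<in> \<A>" "A \<subseteq> E" "r - e < l A" by blast
    then have "ennreal r \<le> ennreal (l A + e)" by (intro ennreal_leI) simp
    also have "\<dots> = ennreal (l A) + ennreal e" using e nonneg[OF A(1)] by simp
    also have "\<dots> \<le> inner_val \<A> l E + ennreal e" by (intro add_right_mono inner_ge A)
    finally show "ennreal r \<le> inner_val \<A> l E + ennreal e" .
  qed
  ultimately have "outer_val \<A> l E = ennreal r" "inner_val \<A> l E = ennreal r"
    using inner_le_outer[of E] by (metis order_antisym order_trans)+
  then show ?L using r by (simp add: completion_ring_def extension_def)
qed

section \<open>Bounds on integrals from the total mass\<close>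

lemma integral_le_bound:
  assumes g: "g \<in> L1 \<A> l" and g0: "\<And>w. 0 \<le> g w" and gK: "\<And>w. g w \<le> K"
    and M: "\<And>E. E \<in> \<A> \<Longrightarrow> l E \<le> M"
  shows "fa_integral \<A> l g \<le> K * M"
proof (rule field_le_epsilon)
  fix e :: real assume "0 < e"
  then obtain s where s: "s \<in> simple_functions \<A>" "fa_integral \<A> l (\<lambda>w. \<bar>g w - s w\<bar>) < e"
    "\<And>w. 0 \<le> s w" "\<And>w. s w \<le> K"
    using simple_approx_bounded[OF g _ g0 gK] by blast
  have K: "0 \<le> K" using g0 gK by (meson order_trans)
  \<comment> \<open>The constant \<open>K\<close> may not be integrable, so the bound is applied on
    the support of \<open>s\<close>, which is a ring set.\<close>
  define A where "A = {w. s w \<noteq> 0}"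
  have A: "A \<in> \<A>" using simple_support[OF s(1)] by (simp add: A_def)
  have "simple_int l s \<le> simple_int l (\<lambda>w. K * indicat_real A w)"
    using s levels_indicator[OF A] by (intro simple_int_mono) (auto simp: simple_iff_levels A_def indicator_def)
  also have "\<dots> = K * l A"
    using simple_int_cmult[OF simple_indicator[OF A]] simple_int_indicator[OF A] by simp
  also have "\<dots> \<le> K * M" by (intro mult_left_mono M A K)
  finally have "fa_integral \<A> l s \<le> K * M" using integral_simple[OF s(1)] by simp
  then show "fa_integral \<A> l g \<le> K * M + e"
    using integral_abs_diff_le[OF g simple_L1[OF s(1)]] s(2) by linarith
qed

lemma is_probability_iff:
  "is_probability \<A> l \<longleftrightarrow> (\<forall>E\<in>\<A>. l E \<le> 1) \<and> (\<forall>\<epsilon>>0. \<exists>E\<in>\<A>. 1 - \<epsilon> < l E)"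
proof
  assume p: "is_probability \<A> l"
  have "l E \<le> 1" if "E \<in> \<A>" for E
  proof -
    have "ennreal (l E) \<le> (SUP E\<in>\<A>. ennreal (l E))" using that by (rule SUP_upper)
    then show ?thesis using p by (simp add: is_probability_def ennreal_le_1)
  qed
  moreover have "\<exists>E\<in>\<A>. 1 - \<epsilon> < l E" if e: "0 < \<epsilon>" for \<epsilon>
  proof (cases "1 - \<epsilon> < 0")
    case True
    then show ?thesis by (intro bexI[of _ "{}"]) auto
  next
    case False
    then have "ennreal (1 - \<epsilon>) < (SUP E\<in>\<A>. ennreal (l E))"
      using p e by (simp add: is_probability_def ennreal_less_one_iff)
    then show ?thesis using False nonneg by (auto simp: less_SUP_iff ennreal_less_iff)
  qed
  ultimately show "(\<forall>E\<in>\<A>. l E \<le> 1) \<and> (\<forall>\<epsilon>>0. \<exists>E\<in>\<A>. 1 - \<epsilon> < l E)" by blast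
next
  assume p: "(\<forall>E\<in>\<A>. l E \<le> 1) \<and> (\<forall>\<epsilon>>0. \<exists>E\<in>\<A>. 1 - \<epsilon> < l E)"
  have "(1::ennreal) \<le> (SUP E\<in>\<A>. ennreal (l E))"
  proof (rule ennreal_le_epsilon)
    fix e :: real assume e: "0 < e"
    with p obtain E where E: "E \<in> \<A>" "1 - e < l E" by blast
    then have "ennreal 1 \<le> ennreal (l E + e)" by (intro ennreal_leI) simp
    also have "\<dots> = ennreal (l E) + ennreal e" using e nonneg[OF E(1)] by simp
    also have "\<dots> \<le> (SUP E\<in>\<A>. ennreal (l E)) + ennreal e" by (intro add_right_mono SUP_upper E)
    finally show "1 \<le> (SUP E\<in>\<A>. ennreal (l E)) + ennreal e" by simp
  qed
  moreover have "(SUP E\<in>\<A>. ennreal (l E)) \<le> 1"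
    using p by (intro SUP_least) (simp add: ennreal_le_1)
  ultimately show "is_probability \<A> l" by (simp add: is_probability_def)
qed

text \<open>Even for a probability the constant \<open>c\<close> need not be integrable. A positive
  \<open>c\<close> is replaced by \<open>c\<close> on a ring set of content near 1; for a negative
  \<open>c\<close> the negative part of \<open>f\<close> is bounded through its supremum and the
  total mass.\<close>

lemma probability_integral_ge:
  assumes p: "is_probability \<A> l" and f: "f \<in> L1 \<A> l" and c: "\<And>w. c \<le> f w"
  shows "c \<le> fa_integral \<A> l f"
proof (cases "0 \<le> c")
  case True
  show ?thesis
  proof (rule field_le_epsilon)
    fix e :: real assume e: "0 < e"
    \<comment> \<open>The denominator \<open>c + 1\<close> makes the loss
      \<open>c * e / (c + 1)\<close> at most \<open>e\<close> and is positive when \<open>c\<close>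
      is 0.\<close>
    then have "0 < e / (c + 1)" using True by simp
    then obtain E where E: "E \<in> \<A>" "1 - e / (c + 1) < l E"
      using p unfolding is_probability_iff by blast
    have "c * l E = fa_integral \<A> l (\<lambda>w. c * indicat_real E w)"
      using integral_cmult[OF simple_L1[OF simple_indicator[OF E(1)]]]
        integral_simple[OF simple_indicator[OF E(1)]] simple_int_indicator[OF E(1)] by simp
    also have "\<dots> \<le> fa_integral \<A> l f"
      using f c order_trans[OF True c]
      by (intro integral_mono L1_cmult simple_L1[OF simple_indicator[OF E(1)]])
        (auto simp: indicator_def)
    finally have "c * l E \<le> fa_integral \<A> l f" .
    moreover have "c * (1 - e / (c + 1)) \<le> c * l E"
      using E True by (intro mult_left_mono) auto
    moreover have "c * (e / (c + 1)) \<le> e" using e True by (simp add: field_simps)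
    ultimately show "c \<le> fa_integral \<A> l f + e" by (simp add: algebra_simps)
  qed
next
  case False
  define g where "g = (\<lambda>w. - 1 * min (f w) 0)"
  have m: "(\<lambda>w. min (f w) 0) \<in> L1 \<A> l" using L1_min_const[OF f, of 0] by simp
  then have g: "g \<in> L1 \<A> l" unfolding g_def by (rule L1_cmult)
  have "fa_integral \<A> l g \<le> - c * 1"
    using g
  proof (rule integral_le_bound)
    show "g w \<le> - c" for w using c[of w] False by (auto simp: g_def)
  qed (use p in \<open>auto simp: g_def is_probability_iff\<close>)
  moreover have "fa_integral \<A> l (\<lambda>w. min (f w) 0) \<le> fa_integral \<A> l f"
    using m f by (rule integral_mono) simp
  ultimately show ?thesis using integral_cmult[OF m, of "- 1"] by (simp add: g_def)
qed

end

section \<open>Enlarging the ring\<close>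

lemma approximating_subring:
  assumes "finadd \<A> l" "finadd \<B> x" "\<A> \<subseteq> \<B>" "\<And>E. E \<in> \<A> \<Longrightarrow> x E = l E"
    and F: "approximating \<A> l f F"
  shows "approximating \<B> x f F" "simple_int x (F n) = simple_int l (F n)"
proof -
  interpret A: finadd \<A> l by fact
  interpret B: finadd \<B> x by fact
  have eq: "simple_int x s = simple_int l s" if "s \<in> simple_functions \<A>" for s
    unfolding simple_int_def using that assms(4)
    by (intro sum.cong) (auto simp: A.simple_iff_levels A.levels_in_ring_def)
  note sF = A.approximatingD(1)[OF F]
  show "simple_int x (F n) = simple_int l (F n)" by (rule eq[OF sF])
  have "\<exists>N. \<forall>n\<ge>N. \<exists>B\<in>\<B>. {w. c < \<bar>F n w - f w\<bar>} \<subseteq> B \<and> x B < \<epsilon>" if pos: "0 < c" "0 < \<epsilon>" for c \<epsilon> :: real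
  proof -
    obtain N where N: "\<forall>n\<ge>N. \<exists>B\<in>\<A>. {w. c < \<bar>F n w - f w\<bar>} \<subseteq> B \<and> l B < \<epsilon>"
      using A.approximatingD(2)[OF F pos] by blast
    have "\<exists>B\<in>\<B>. {w. c < \<bar>F n w - f w\<bar>} \<subseteq> B \<and> x B < \<epsilon>" if "n \<ge> N" for n
    proof -
      obtain B where "B \<in> \<A>" "{w. c < \<bar>F n w - f w\<bar>} \<subseteq> B" "l B < \<epsilon>" using N \<open>n \<ge> N\<close> by blast
      then show ?thesis using assms(3,4) by (intro bexI[of _ B]) auto
    qed
    then show ?thesis by blast
  qed
  moreover have "F n \<in> simple_functions \<B>" for n
    using sF[of n] assms(3) by (auto simp: A.simple_iff_levels B.simple_iff_levels
        A.levels_in_ring_def B.levels_in_ring_def)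
  moreover have "\<exists>N. \<forall>n\<ge>N. \<forall>k\<ge>N. simple_int x (\<lambda>w. \<bar>F n w - F k w\<bar>) < \<epsilon>" if "0 < \<epsilon>" for \<epsilon>
    using A.approximatingD(3)[OF F that] eq[OF A.simple_abs_diff[OF sF sF]] by simp
  ultimately show "approximating \<B> x f F"
    by (simp add: approximating_def B.converges_iff)
qed

lemma L1_subring:
  assumes "finadd \<A> l" "finadd \<B> x" "\<A> \<subseteq> \<B>" "\<And>E. E \<in> \<A> \<Longrightarrow> x E = l E" "f \<in> L1 \<A> l"
  shows "f \<in> L1 \<B> x" "fa_integral \<B> x f = fa_integral \<A> l f"
proof -
  obtain F where F: "approximating \<A> l f F" using assms(5) by (auto simp: L1_def)
  note F' = approximating_subring[OF assms(1-4) F]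
  show "f \<in> L1 \<B> x" using finadd.L1I[OF assms(2) F'(1)] .
  show "fa_integral \<B> x f = fa_integral \<A> l f"
    using finadd.approximating_integral[OF assms(1) F] finadd.approximating_integral[OF assms(2) F'(1)]
      F'(2) LIMSEQ_unique by simp
qed

text \<open>The missing mass \<open>1 - sup l\<close> is put at infinity: complements of ring sets
  are adjoined and receive the complementary value. Since the whole space is not in the ring, no set
  is both a member and the complement of a member, so the definition is unambiguous.\<close>

lemma (in finadd) probability_extension:
  assumes U: "UNIV \<notin> \<A>" and le1: "\<And>E. E \<in> \<A> \<Longrightarrow> l E \<le> 1"
  obtains \<B> x where "measure_structure \<B> x" "is_probability \<B> x" "\<A> \<subseteq> \<B>" "\<And>E. E \<in> \<A> \<Longrightarrow> x E = l E"
proof -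
  define \<B> where "\<B> = {E. E \<in> \<A> \<or> - E \<in> \<A>}"
  define x where "x E = (if E \<in> \<A> then l E else 1 - l (- E))" for E
  have nb: "- E \<notin> \<A>" if "E \<in> \<A>" for E
    using Un[OF that, of "- E"] U by auto
  have "E - F \<in> \<B>" "E \<union> F \<in> \<B>" if "E \<in> \<B>" "F \<in> \<B>" for E F
  proof -
    have eq: "- (E - F) = - E \<union> F" "E - F = (- F) - (- E)" "E - F = E \<inter> - F"
      "- (E \<union> F) = - E - F" "- (E \<union> F) = - F - E" "- (E \<union> F) = - E \<inter> - F" by auto
    consider "E \<in> \<A>" "F \<in> \<A>" | "E \<in> \<A>" "- F \<in> \<A>" | "- E \<in> \<A>" "F \<in> \<A>" | "- E \<in> \<A>" "- F \<in> \<A>"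
      using \<open>E \<in> \<B>\<close> \<open>F \<in> \<B>\<close> by (auto simp: \<B>_def)
    then have "(E - F \<in> \<A> \<or> - (E - F) \<in> \<A>) \<and> (E \<union> F \<in> \<A> \<or> - (E \<union> F) \<in> \<A>)"
    proof cases
      case 1
      then show ?thesis by (blast intro: Diff Un)
    next
      case 2
      then have "E \<inter> - F \<in> \<A>" "- F - E \<in> \<A>" by (blast intro: Diff Int)+
      then show ?thesis using eq by metis
    next
      case 3
      then have "- E \<union> F \<in> \<A>" "- E - F \<in> \<A>" by (blast intro: Diff Un)+
      then show ?thesis using eq by metis
    next
      case 4
      then have "(- F) - (- E) \<in> \<A>" "- E \<inter> - F \<in> \<A>" by (blast intro: Diff Int)+
      then show ?thesis using eq by metis
    qed
    then show "E - F \<in> \<B>" "E \<union> F \<in> \<B>" by (auto simp: \<B>_def)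
  qed
  then have "ring_of_sets UNIV \<B>"
    by (auto simp: ring_of_sets_iff) (auto simp: \<B>_def)
  moreover have "0 \<le> x E" if "E \<in> \<B>" for E
    using that nonneg le1 by (auto simp: x_def \<B>_def)
  moreover have "x (E \<union> F) = x E + x F" if EF: "E \<in> \<B>" "F \<in> \<B>" "E \<inter> F = {}" for E F
  proof -
    \<comment> \<open>For a ring set \<open>E\<close> disjoint from a complement \<open>F\<close>,
      the ring set \<open>- F\<close> splits into \<open>E\<close> and
      \<open>- (E \<union> F)\<close>; additivity of \<open>l\<close> is applied to this
      splitting.\<close>
    have mixed: "x (E \<union> F) = x E + x F" if "E \<in> \<A>" "- F \<in> \<A>" "E \<inter> F = {}" for E F
    proof -
      have eq: "- F = E \<union> - (E \<union> F)" and eq': "- (E \<union> F) = - F - E" using that(3) by auto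
      have D: "- (E \<union> F) \<in> \<A>" unfolding eq' using that by (intro Diff)
      have "l (- F) = l E + l (- (E \<union> F))"
      proof -
        have "E \<inter> - (E \<union> F) = {}" by auto
        from add_disjoint[OF that(1) D this] show ?thesis unfolding eq[symmetric] .
      qed
      moreover have "E \<union> F \<notin> \<A>" "F \<notin> \<A>" using nb D that(2) by (metis double_compl)+
      ultimately show ?thesis using that(1) by (simp add: x_def)
    qed
    consider "E \<in> \<A>" "F \<in> \<A>" | "E \<in> \<A>" "- F \<in> \<A>" | "- E \<in> \<A>" "F \<in> \<A>" | "- E \<in> \<A>" "- F \<in> \<A>"
      using EF by (auto simp: \<B>_def)
    then show ?thesis
    proof cases
      case 1
      then show ?thesis using EF(3) add_disjoint Un by (simp add: x_def)
    next
      case 2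
      then show ?thesis using mixed EF(3) by blast
    next
      case 3
      have "F \<inter> E = {}" using EF(3) by blast
      from mixed[OF 3(2,1) this] show ?thesis by (simp add: Un_commute add.commute)
    next
      case 4
      \<comment> \<open>Two disjoint complements would exhibit the whole space as a union of two
        ring sets.\<close>
      have "- E \<union> - F = UNIV" using EF(3) by auto
      with Un[OF 4] U show ?thesis by simp
    qed
  qed
  ultimately have ms: "measure_structure \<B> x"
    by (simp add: measure_structure_def Measure_Space.additive_def)
  then interpret B: finadd \<B> x by unfold_locales
  have "UNIV \<in> \<B>" "x UNIV = 1" using U by (auto simp: \<B>_def x_def)
  moreover have "x E \<le> 1" if "E \<in> \<B>" for E
    using that nonneg le1 by (auto simp: x_def \<B>_def)
  ultimately have "is_probability \<B> x"
    unfolding B.is_probability_iff by (intro conjI allI impI ballI bexI[of _ UNIV]) auto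
  then show ?thesis using that[OF ms] by (auto simp: \<B>_def x_def)
qed


section \<open>The Jordan content of a Stonean functional\<close>

text \<open>An elementary integral with the monotone continuity of Daniell replaced by continuity
  under truncation, \<open>phi_small\<close> and \<open>phi_large\<close>. Every finitely additive
  integral has both properties, so nothing weaker could be represented.\<close>

locale stone_functional =
  fixes L :: "('b \<Rightarrow> real) set" and \<phi> :: "('b \<Rightarrow> real) \<Rightarrow> real"
  assumes zero_in: "(\<lambda>w. 0) \<in> L"
    and add_in: "\<lbrakk>f \<in> L; g \<in> L\<rbrakk> \<Longrightarrow> (\<lambda>w. f w + g w) \<in> L"
    and cmult_in: "f \<in> L \<Longrightarrow> (\<lambda>w. c * f w) \<in> L"
    and max_in: "\<lbrakk>f \<in> L; g \<in> L\<rbrakk> \<Longrightarrow> (\<lambda>w. max (f w) (g w)) \<in> L"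
    and min_in: "\<lbrakk>f \<in> L; g \<in> L\<rbrakk> \<Longrightarrow> (\<lambda>w. min (f w) (g w)) \<in> L"
    and min_one_in: "f \<in> L \<Longrightarrow> (\<lambda>w. min (f w) 1) \<in> L"
    and phi_add: "\<lbrakk>f \<in> L; g \<in> L\<rbrakk> \<Longrightarrow> \<phi> (\<lambda>w. f w + g w) = \<phi> f + \<phi> g"
    and phi_cmult: "f \<in> L \<Longrightarrow> \<phi> (\<lambda>w. c * f w) = c * \<phi> f"
    and phi_nonneg: "\<lbrakk>f \<in> L; \<And>w. 0 \<le> f w\<rbrakk> \<Longrightarrow> 0 \<le> \<phi> f"
    and phi_small: "\<lbrakk>f \<in> L; \<And>w. 0 \<le> f w; 0 < \<epsilon>\<rbrakk> \<Longrightarrow> \<exists>\<delta>>0. \<phi> (\<lambda>w. min (f w) \<delta>) < \<epsilon>"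
    and phi_large: "\<lbrakk>f \<in> L; \<And>w. 0 \<le> f w; 0 < \<epsilon>\<rbrakk> \<Longrightarrow> \<exists>M>0. \<phi> f - \<phi> (\<lambda>w. min (f w) M) < \<epsilon>"
begin

lemma diff_in: "\<lbrakk>f \<in> L; g \<in> L\<rbrakk> \<Longrightarrow> (\<lambda>w. f w - g w) \<in> L"
  and phi_diff: "\<lbrakk>f \<in> L; g \<in> L\<rbrakk> \<Longrightarrow> \<phi> (\<lambda>w. f w - g w) = \<phi> f - \<phi> g"
  using add_in[OF _ cmult_in[of g "- 1"], of f] phi_add[OF _ cmult_in[of g "- 1"], of f]
    phi_cmult[of g "- 1"] by auto

lemma phi_mono: "\<lbrakk>f \<in> L; g \<in> L; \<And>w. f w \<le> g w\<rbrakk> \<Longrightarrow> \<phi> f \<le> \<phi> g"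
  using phi_nonneg[OF diff_in[of g f]] phi_diff[of g f] by simp

lemma pos_in: "f \<in> L \<Longrightarrow> (\<lambda>w. max (f w) 0) \<in> L"
  using max_in[OF _ zero_in] by simp

lemma min_const_in:
  assumes "f \<in> L" "0 \<le> c"
  shows "(\<lambda>w. min (f w) c) \<in> L"
proof (cases "c = 0")
  case True
  then show ?thesis using min_in[OF assms(1) zero_in] by simp
next
  case False
  then have "(\<lambda>w. c * min (1 / c * f w) 1) = (\<lambda>w. min (f w) c)"
    using assms(2) by (auto simp: min_def field_simps)
  then show ?thesis using cmult_in[OF min_one_in[OF cmult_in[OF assms(1)]], of c "1 / c"] by simp
qed

section \<open>Jordan measurable sets and their content\<close>

definition jordan_ring :: "'b set set" where
  "jordan_ring = {E. \<forall>\<epsilon>>0. \<exists>g\<in>L. \<exists>f\<in>L.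
     (\<forall>w. g w \<le> indicat_real E w \<and> indicat_real E w \<le> f w) \<and> \<phi> f - \<phi> g < \<epsilon>}"

text \<open>An outer content, defined for all sets because level sets are compared through it before
  they are known to be Jordan measurable. For a set without a majorant in \<open>L\<close> the
  infimum runs over the empty set and carries no information, so the lemmas about it supply a
  majorant.\<close>

definition jordan_content :: "'b set \<Rightarrow> real" where
  "jordan_content E = (INF f\<in>{f\<in>L. \<forall>w. indicat_real E w \<le> f w}. \<phi> f)"

lemma bdd_below_content: "bdd_below (\<phi> ` {f\<in>L. \<forall>w. indicat_real E w \<le> f w})"
proof (rule bdd_belowI2[where m = 0])
  fix f assume f: "f \<in> {f\<in>L. \<forall>w. indicat_real E w \<le> f w}"
  have "0 \<le> f w" for w
    using f order_trans[OF indicator_pos_le[of E w]] by auto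
  then show "0 \<le> \<phi> f" using f by (intro phi_nonneg) auto
qed

lemma content_le:
  assumes "f \<in> L" "\<And>w. indicat_real E w \<le> f w"
  shows "jordan_content E \<le> \<phi> f"
  unfolding jordan_content_def using assms by (intro cINF_lower bdd_below_content) auto

lemma content_ge:
  assumes "f \<in> L" "\<And>w. indicat_real E w \<le> f w" "g \<in> L" "\<And>w. g w \<le> indicat_real E w"
  shows "\<phi> g \<le> jordan_content E"
  unfolding jordan_content_def
proof (rule cINF_greatest)
  show "{f\<in>L. \<forall>w. indicat_real E w \<le> f w} \<noteq> {}" using assms(1,2) by blast
  show "\<phi> g \<le> \<phi> h" if "h \<in> {f\<in>L. \<forall>w. indicat_real E w \<le> f w}" for h
    using that assms(3) order_trans[OF assms(4)] by (intro phi_mono) auto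
qed

lemma content_mono:
  assumes "f \<in> L" "\<And>w. indicat_real F w \<le> f w" "E \<subseteq> F"
  shows "jordan_content E \<le> jordan_content F"
  unfolding jordan_content_def
proof (rule cINF_superset_mono[OF _ bdd_below_content])
  show "{f\<in>L. \<forall>w. indicat_real F w \<le> f w} \<noteq> {}" using assms(1,2) by blast
  have "indicat_real E w \<le> indicat_real F w" for w using assms(3) by (auto simp: indicator_def)
  then show "{f\<in>L. \<forall>w. indicat_real F w \<le> f w} \<subseteq> {f\<in>L. \<forall>w. indicat_real E w \<le> f w}"
    using order_trans by blast
qed simp

lemma jordan_approx:
  assumes E: "E \<in> jordan_ring" and e: "0 < \<epsilon>"
  obtains g f where "g \<in> L" "f \<in> L" "\<And>w. 0 \<le> g w" "\<And>w. g w \<le> indicat_real E w"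
    "\<And>w. indicat_real E w \<le> f w" "jordan_content E - \<epsilon> < \<phi> g" "\<phi> f < jordan_content E + \<epsilon>"
proof -
  obtain g f where gf: "g \<in> L" "f \<in> L" "\<And>w. g w \<le> indicat_real E w"
    "\<And>w. indicat_real E w \<le> f w" "\<phi> f - \<phi> g < \<epsilon>"
    using E e unfolding jordan_ring_def by blast
  have g': "max (g w) 0 \<le> indicat_real E w" for w using gf(3)[of w] by simp
  have "\<phi> g \<le> \<phi> (\<lambda>w. max (g w) 0)" using gf(1) pos_in by (intro phi_mono) auto
  moreover have "\<phi> (\<lambda>w. max (g w) 0) \<le> jordan_content E"
    using content_ge[OF gf(2,4) pos_in[OF gf(1)] g'] .
  moreover have "jordan_content E \<le> \<phi> f" using content_le[OF gf(2,4)] .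
  ultimately show ?thesis
    using that[OF pos_in[OF gf(1)] gf(2) _ g' gf(4)] gf(5) by auto
qed

lemma jordanI:
  assumes "\<And>\<epsilon>. 0 < \<epsilon> \<Longrightarrow> \<exists>g\<in>L. \<exists>f\<in>L. (\<forall>w. g w \<le> indicat_real E w \<and> indicat_real E w \<le> f w)
    \<and> c - \<epsilon> < \<phi> g \<and> \<phi> f < c + \<epsilon>"
  shows "E \<in> jordan_ring" "jordan_content E = c"
proof -
  have "\<exists>g\<in>L. \<exists>f\<in>L. (\<forall>w. g w \<le> indicat_real E w \<and> indicat_real E w \<le> f w) \<and> \<phi> f - \<phi> g < \<epsilon>"
    if e: "0 < \<epsilon>" for \<epsilon>
  proof -
    obtain g f where "g \<in> L" "f \<in> L" "\<forall>w. g w \<le> indicat_real E w \<and> indicat_real E w \<le> f w"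
      "c - \<epsilon> / 2 < \<phi> g" "\<phi> f < c + \<epsilon> / 2" using assms[of "\<epsilon> / 2"] e by auto
    then show ?thesis by (intro bexI[of _ g] bexI[of _ f]) auto
  qed
  then show "E \<in> jordan_ring" by (simp add: jordan_ring_def)
  have "jordan_content E \<le> c + \<epsilon> \<and> c \<le> jordan_content E + \<epsilon>" if e: "0 < \<epsilon>" for \<epsilon>
  proof -
    obtain g f where "g \<in> L" "f \<in> L" "\<And>w. g w \<le> indicat_real E w" "\<And>w. indicat_real E w \<le> f w"
      "c - \<epsilon> < \<phi> g" "\<phi> f < c + \<epsilon>" using assms[OF e] by blast
    then show ?thesis using content_le[of f E] content_ge[of f E g] by auto
  qed
  then show "jordan_content E = c"
    by (meson antisym field_le_epsilon)
qed

text \<open>Squeezing functions are combined by \<open>max\<close> for the union and by the positive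
  part of a difference for \<open>E - F\<close>, where the majorant of one set meets the minorant of
  the other. In both cases the new gap is at most the sum of the two old gaps, pointwise and hence
  under \<phi>.\<close>

lemma jordan_setop:
  assumes E: "E \<in> jordan_ring" and F: "F \<in> jordan_ring"
  shows "E \<union> F \<in> jordan_ring" "E - F \<in> jordan_ring"
proof -
  have "\<exists>g\<in>L. \<exists>f\<in>L. (\<forall>w. g w \<le> indicat_real (E \<union> F) w \<and> indicat_real (E \<union> F) w \<le> f w) \<and> \<phi> f - \<phi> g < \<epsilon>"
    and "\<exists>g\<in>L. \<exists>f\<in>L. (\<forall>w. g w \<le> indicat_real (E - F) w \<and> indicat_real (E - F) w \<le> f w) \<and> \<phi> f - \<phi> g < \<epsilon>"
    if e: "0 < \<epsilon>" for \<epsilon>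
  proof -
    obtain g f where E': "g \<in> L" "f \<in> L" "\<And>w. g w \<le> indicat_real E w" "\<And>w. indicat_real E w \<le> f w"
      "\<phi> f - \<phi> g < \<epsilon> / 2" using E e unfolding jordan_ring_def mem_Collect_eq by (meson half_gt_zero)
    obtain g' f' where F': "g' \<in> L" "f' \<in> L" "\<And>w. g' w \<le> indicat_real F w" "\<And>w. indicat_real F w \<le> f' w"
      "\<phi> f' - \<phi> g' < \<epsilon> / 2" using F e unfolding jordan_ring_def mem_Collect_eq by (meson half_gt_zero)
    have s: "(\<lambda>w. (f w - g w) + (f' w - g' w)) \<in> L"
      and sum: "\<phi> (\<lambda>w. (f w - g w) + (f' w - g' w)) < \<epsilon>"
      using E' F' add_in[OF diff_in diff_in, of f g f' g'] phi_add[OF diff_in diff_in, of f g f' g']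
        phi_diff[of f g] phi_diff[of f' g'] by auto
    have gf: "g w \<le> f w" "g' w \<le> f' w" for w
      using E'(3,4)[of w] F'(3,4)[of w] by auto
    note U = max_in[OF E'(2) F'(2)] max_in[OF E'(1) F'(1)]
    have "\<phi> (\<lambda>w. max (f w) (f' w) - max (g w) (g' w)) \<le> \<phi> (\<lambda>w. (f w - g w) + (f' w - g' w))"
    proof (intro phi_mono s diff_in U)
      show "max (f w) (f' w) - max (g w) (g' w) \<le> (f w - g w) + (f' w - g' w)" for w
        using gf[of w] by (auto simp: max_def)
    qed
    then have "\<phi> (\<lambda>w. max (f w) (f' w)) - \<phi> (\<lambda>w. max (g w) (g' w)) < \<epsilon>"
      using phi_diff[OF U] sum by simp
    moreover have "max (g w) (g' w) \<le> indicat_real (E \<union> F) w \<and> indicat_real (E \<union> F) w \<le> max (f w) (f' w)" for w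
      using E'(3,4)[of w] F'(3,4)[of w] by (cases "w \<in> E"; cases "w \<in> F") auto
    ultimately show "\<exists>g\<in>L. \<exists>f\<in>L. (\<forall>w. g w \<le> indicat_real (E \<union> F) w \<and> indicat_real (E \<union> F) w \<le> f w) \<and> \<phi> f - \<phi> g < \<epsilon>"
      by (intro bexI[OF _ U(2)] bexI[OF _ U(1)]) simp
    note D = pos_in[OF diff_in[OF E'(2) F'(1)]] pos_in[OF diff_in[OF E'(1) F'(2)]]
    have "\<phi> (\<lambda>w. max (f w - g' w) 0 - max (g w - f' w) 0) \<le> \<phi> (\<lambda>w. (f w - g w) + (f' w - g' w))"
    proof (intro phi_mono s diff_in D)
      show "max (f w - g' w) 0 - max (g w - f' w) 0 \<le> (f w - g w) + (f' w - g' w)" for w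
        using gf[of w] by (auto simp: max_def)
    qed
    then have "\<phi> (\<lambda>w. max (f w - g' w) 0) - \<phi> (\<lambda>w. max (g w - f' w) 0) < \<epsilon>"
      using phi_diff[OF D] sum by simp
    moreover have "max (g w - f' w) 0 \<le> indicat_real (E - F) w \<and> indicat_real (E - F) w \<le> max (f w - g' w) 0" for w
      using E'(3,4)[of w] F'(3,4)[of w] by (cases "w \<in> E"; cases "w \<in> F") auto
    ultimately show "\<exists>g\<in>L. \<exists>f\<in>L. (\<forall>w. g w \<le> indicat_real (E - F) w \<and> indicat_real (E - F) w \<le> f w) \<and> \<phi> f - \<phi> g < \<epsilon>"
      by (intro bexI[OF _ D(2)] bexI[OF _ D(1)]) simp
  qed
  then show "E \<union> F \<in> jordan_ring" "E - F \<in> jordan_ring" by (simp_all add: jordan_ring_def)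
qed

lemma jordan_additive:
  assumes E: "E \<in> jordan_ring" and F: "F \<in> jordan_ring" and EF: "E \<inter> F = {}"
  shows "jordan_content (E \<union> F) = jordan_content E + jordan_content F"
proof (rule jordanI(2))
  fix \<epsilon> :: real assume e: "0 < \<epsilon>"
  obtain g f where E': "g \<in> L" "f \<in> L" "\<And>w. g w \<le> indicat_real E w" "\<And>w. indicat_real E w \<le> f w"
    "jordan_content E - \<epsilon> / 2 < \<phi> g" "\<phi> f < jordan_content E + \<epsilon> / 2"
    using jordan_approx[OF E, of "\<epsilon> / 2"] e by (metis half_gt_zero)
  obtain g' f' where F': "g' \<in> L" "f' \<in> L" "\<And>w. g' w \<le> indicat_real F w" "\<And>w. indicat_real F w \<le> f' w"
    "jordan_content F - \<epsilon> / 2 < \<phi> g'" "\<phi> f' < jordan_content F + \<epsilon> / 2"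
    using jordan_approx[OF F, of "\<epsilon> / 2"] e by (metis half_gt_zero)
  have ind: "indicat_real (E \<union> F) w = indicat_real E w + indicat_real F w" for w
    using EF by (auto simp: indicator_def)
  show "\<exists>g\<in>L. \<exists>f\<in>L. (\<forall>w. g w \<le> indicat_real (E \<union> F) w \<and> indicat_real (E \<union> F) w \<le> f w)
    \<and> jordan_content E + jordan_content F - \<epsilon> < \<phi> g \<and> \<phi> f < jordan_content E + jordan_content F + \<epsilon>"
    unfolding ind
    using E' F' phi_add[OF E'(1) F'(1)] phi_add[OF E'(2) F'(2)]
    by (intro bexI[OF _ add_in[OF E'(1) F'(1)]] bexI[OF _ add_in[OF E'(2) F'(2)]])
      (auto intro: add_mono)
qed

lemma measure_structure_jordan: "measure_structure jordan_ring jordan_content"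
proof -
  have "{} \<in> jordan_ring"
    using zero_in by (auto simp: jordan_ring_def intro!: bexI[of _ "\<lambda>w. 0"])
  then have "ring_of_sets UNIV jordan_ring"
    using jordan_setop by (auto simp: ring_of_sets_iff)
  moreover have "0 \<le> jordan_content E" if "E \<in> jordan_ring" for E
  proof -
    obtain f where "f \<in> L" "\<And>w. indicat_real E w \<le> f w"
      using jordan_approx[OF \<open>E \<in> jordan_ring\<close> zero_less_one] by metis
    from content_ge[OF this zero_in] have "\<phi> (\<lambda>w. 0) \<le> jordan_content E" by simp
    then show ?thesis using phi_nonneg[OF zero_in] by simp
  qed
  moreover have "Measure_Space.additive jordan_ring jordan_content"
    using jordan_additive by (simp add: Measure_Space.additive_def)
  ultimately show ?thesis by (simp add: measure_structure_def)
qed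

sublocale finadd jordan_ring jordan_content
  by unfold_locales (rule measure_structure_jordan)

text \<open>The strict level set of \<open>f\<close> at a prescribed level may fail to be Jordan
  measurable, and all applications tolerate some freedom in the level. The minorants are difference
  quotients of truncations; the majorants come from the infimum that defines the content.\<close>

lemma jordan_between:
  assumes f: "f \<in> L" and f0: "\<And>w. 0 \<le> f w" and ab: "0 < a" "a < b"
  obtains E where "E \<in> jordan_ring" "{w. b \<le> f w} \<subseteq> E" "E \<subseteq> {w. a < f w}"
proof -
  define D where "D = (\<lambda>t. jordan_content {w. t < f w})"
  have upper: "indicat_real {w. t < f w} w \<le> 1 / t * f w" if "0 < t" for t w
    using that f0[of w] by (auto simp: indicator_def field_simps)
  \<comment> \<open>The sign turns a decreasing function into an increasing one. On this interval
    the levels are positive, so \<open>1 / t * f\<close> is a majorant and \<open>D\<close> is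
    meaningful.\<close>
  have "mono_on {a<..<b} (\<lambda>t. - D t)"
  proof (rule mono_onI)
    fix r s assume rs: "r \<in> {a<..<b}" "s \<in> {a<..<b}" "r \<le> s"
    then show "- D r \<le> - D s"
      unfolding D_def neg_le_iff_le
      using ab by (intro content_mono[OF cmult_in[OF f] upper[of r]]) auto
  qed
  then have "countable {t\<in>{a<..<b}. \<not> continuous (at t within {a<..<b}) (\<lambda>t. - D t)}"
    by (rule mono_on_ctble_discont)
  then have "{t\<in>{a<..<b}. \<not> continuous (at t within {a<..<b}) (\<lambda>t. - D t)} \<noteq> {a<..<b}"
    using uncountable_open_interval[of a b] ab(2) by metis
  then obtain t where "t \<in> {a<..<b}" and t: "continuous (at t within {a<..<b}) (\<lambda>t. - D t)"
    by blast
  then have t: "a < t" "t < b" "continuous (at t within {a<..<b}) (\<lambda>t. - D t)" by simp_all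
  have "{w. t < f w} \<in> jordan_ring"
  proof (rule jordanI(1)[where c = "D t"])
    fix \<epsilon> :: real assume e: "0 < \<epsilon>"
    obtain d where d: "0 < d" "\<And>x. x \<in> {a<..<b} \<Longrightarrow> dist x t < d \<Longrightarrow> dist (- D x) (- D t) < \<epsilon>"
      using t(3) e unfolding continuous_within_eps_delta by metis
    \<comment> \<open>Halving makes both bounds strict: \<open>t + h\<close> stays in the interval
      and within the continuity radius of \<open>t\<close>.\<close>
    define h where "h = min d (b - t) / 2"
    have "h \<le> (b - t) / 2" by (simp add: h_def)
    then have h: "0 < h" "h < d" "t + h < b" using d t by (auto simp: h_def min_def)
    have Dh: "D t - \<epsilon> < D (t + h)"
      using d(2)[of "t + h"] h t by (auto simp: dist_real_def)
    define v where "v = (\<lambda>w. 1 / h * (min (f w) (t + h) - min (f w) t))"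
    have v: "v \<in> L"
      unfolding v_def using f ab t h by (intro cmult_in diff_in min_const_in) auto
    have vle: "v w \<le> indicat_real {w. t < f w} w" for w
      using h by (auto simp: v_def indicator_def min_def field_simps)
    have "indicat_real {w. t + h < f w} w \<le> v w" for w
      using h by (auto simp: v_def indicator_def min_def field_simps)
    from content_le[OF v this] have vge: "D (t + h) \<le> \<phi> v" by (simp add: D_def)
    have "(INF u\<in>{u\<in>L. \<forall>w. indicat_real {w. t < f w} w \<le> u w}. \<phi> u) < D t + \<epsilon>"
      using e by (simp add: D_def jordan_content_def)
    moreover have "{u\<in>L. \<forall>w. indicat_real {w. t < f w} w \<le> u w} \<noteq> {}"
      using cmult_in[OF f, of "1 / t"] upper[of t] ab t by (auto intro!: exI[of _ "\<lambda>w. 1 / t * f w"])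
    ultimately obtain u where u: "u \<in> L" "\<And>w. indicat_real {w. t < f w} w \<le> u w" "\<phi> u < D t + \<epsilon>"
      using cINF_less_iff[OF _ bdd_below_content] by blast
    show "\<exists>g\<in>L. \<exists>u\<in>L. (\<forall>w. g w \<le> indicat_real {w. t < f w} w \<and> indicat_real {w. t < f w} w \<le> u w)
      \<and> D t - \<epsilon> < \<phi> g \<and> \<phi> u < D t + \<epsilon>"
      using v vle vge Dh u by (intro bexI[of _ v] bexI[of _ u]) auto
  qed
  then show ?thesis
  proof (rule that)
    show "{w. b \<le> f w} \<subseteq> {w. t < f w}" "{w. t < f w} \<subseteq> {w. a < f w}" using t by auto
  qed
qed

text \<open>Links integrals of Jordan simple functions to \<phi> before the members of
  \<open>L\<close> are known to be integrable. Each term is replaced by the minorant or the majorant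
  of its set, according to the sign of the coefficient.\<close>

lemma simple_minorant:
  assumes "s \<in> simple_functions jordan_ring" "0 < \<epsilon>"
  shows "\<exists>g\<in>L. (\<forall>w. g w \<le> s w) \<and> simple_int jordan_content s - \<epsilon> < \<phi> g"
proof -
  obtain n :: nat and c E where "\<forall>i<n. E i \<in> jordan_ring"
    and s: "s = (\<lambda>w. \<Sum>i<n. c i * indicat_real (E i) w)"
    using assms(1) unfolding simple_functions_def by blast
  then have "\<exists>g\<in>L. (\<forall>w. g w \<le> (\<Sum>i<n. c i * indicat_real (E i) w))
      \<and> simple_int jordan_content (\<lambda>w. \<Sum>i<n. c i * indicat_real (E i) w) - \<epsilon> < \<phi> g"
    using assms(2)
  proof (induction n arbitrary: \<epsilon> s)
    case 0
    then show ?case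
      using phi_nonneg[OF zero_in] by (intro bexI[OF _ zero_in]) auto
  next
    case (Suc n)
    then have En: "E n \<in> jordan_ring" by simp
    have s1: "(\<lambda>w. \<Sum>i<n. c i * indicat_real (E i) w) \<in> simple_functions jordan_ring"
      unfolding simple_functions_def using Suc.prems by (intro CollectI exI[of _ n] exI conjI refl) auto
    have s2: "(\<lambda>w. c n * indicat_real (E n) w) \<in> simple_functions jordan_ring"
      using levels_indicator[OF En] by (simp add: simple_iff_levels)
    have I: "simple_int jordan_content (\<lambda>w. \<Sum>i<Suc n. c i * indicat_real (E i) w) =
        simple_int jordan_content (\<lambda>w. \<Sum>i<n. c i * indicat_real (E i) w) + c n * jordan_content (E n)"
      using simple_int_add[OF s1 s2] simple_int_cmult[OF simple_indicator[OF En]]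
        simple_int_indicator[OF En] by simp
    obtain g where g: "g \<in> L" "\<And>w. g w \<le> (\<Sum>i<n. c i * indicat_real (E i) w)"
      "simple_int jordan_content (\<lambda>w. \<Sum>i<n. c i * indicat_real (E i) w) - \<epsilon> / 2 < \<phi> g"
      using Suc.IH[of "\<lambda>w. \<Sum>i<n. c i * indicat_real (E i) w" "\<epsilon> / 2"] Suc.prems by auto
    \<comment> \<open>After multiplication by the coefficient the error is at most \<epsilon> / 2,
      also for a coefficient 0.\<close>
    define \<eta> where "\<eta> = \<epsilon> / (2 * (\<bar>c n\<bar> + 1))"
    have eta: "0 < \<eta>" "\<bar>c n\<bar> * \<eta> \<le> \<epsilon> / 2" using Suc.prems by (auto simp: \<eta>_def field_simps)
    obtain g' f' where E': "g' \<in> L" "f' \<in> L" "\<And>w. g' w \<le> indicat_real (E n) w"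
      "\<And>w. indicat_real (E n) w \<le> f' w"
      "jordan_content (E n) - \<eta> < \<phi> g'" "\<phi> f' < jordan_content (E n) + \<eta>"
      using jordan_approx[OF En eta(1)] by metis
    have "\<exists>k\<in>L. (\<forall>w. k w \<le> c n * indicat_real (E n) w) \<and> c n * jordan_content (E n) - \<epsilon> / 2 \<le> \<phi> k"
    proof (cases "0 \<le> c n")
      case True
      have "c n * (jordan_content (E n) - \<eta>) \<le> c n * \<phi> g'" using True E' by (intro mult_left_mono) auto
      then show ?thesis using True E' eta phi_cmult[OF E'(1), of "c n"]
        by (intro bexI[OF _ cmult_in[OF E'(1), of "c n"]]) (auto intro: mult_left_mono simp: algebra_simps)
    next
      case False
      have "c n * (jordan_content (E n) + \<eta>) \<le> c n * \<phi> f'"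
        using False E' by (intro mult_left_mono_neg) auto
      then show ?thesis using False E' eta phi_cmult[OF E'(2), of "c n"]
        by (intro bexI[OF _ cmult_in[OF E'(2), of "c n"]]) (auto intro: mult_left_mono_neg simp: algebra_simps)
    qed
    then obtain k where k: "k \<in> L" "\<And>w. k w \<le> c n * indicat_real (E n) w"
      "c n * jordan_content (E n) - \<epsilon> / 2 \<le> \<phi> k" by blast
    show ?case
      unfolding I using g k phi_add[OF g(1) k(1)]
      by (intro bexI[OF _ add_in[OF g(1) k(1)]]) (auto intro: add_mono)
  qed
  then show ?thesis by (simp add: s)
qed

lemma simple_int_le_phi:
  assumes s: "s \<in> simple_functions jordan_ring" and f: "f \<in> L" and le: "\<And>w. s w \<le> f w"
  shows "simple_int jordan_content s \<le> \<phi> f"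
proof (rule field_le_epsilon)
  fix e :: real assume "0 < e"
  then obtain g where g: "g \<in> L" "\<And>w. g w \<le> s w" "simple_int jordan_content s - e < \<phi> g"
    using simple_minorant[OF s] by blast
  have "\<phi> g \<le> \<phi> f" using g(1) f order_trans[OF g(2) le] by (rule phi_mono)
  then show "simple_int jordan_content s \<le> \<phi> f + e" using g by simp
qed

lemma phi_le_simple_int:
  assumes s: "s \<in> simple_functions jordan_ring" and f: "f \<in> L" and le: "\<And>w. f w \<le> s w"
  shows "\<phi> f \<le> simple_int jordan_content s"
proof -
  have s': "(\<lambda>w. - 1 * s w) \<in> simple_functions jordan_ring" using simple_unop[OF s, of "(*) (- 1)"] by simp
  have "simple_int jordan_content (\<lambda>w. - 1 * s w) \<le> \<phi> (\<lambda>w. - 1 * f w)"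
    by (rule simple_int_le_phi[OF s' cmult_in[OF f]]) (use le in simp)
  then show ?thesis using simple_int_cmult[OF s, of "- 1"] phi_cmult[OF f, of "- 1"] by simp
qed

text \<open>A layer-cake sum: \<open>f\<close> is cut into slices of height \<delta>, and each slice
  is compared with \<delta> times the indicator of a Jordan set. The sums telescope, leaving an
  error only below \<open>2 * \<delta>\<close> and above \<open>M\<close>, both controlled by the
  truncation properties.\<close>

lemma simple_sandwich:
  assumes f: "f \<in> L" and f0: "\<And>w. 0 \<le> f w" and e: "0 < \<epsilon>"
  obtains s d where "s \<in> simple_functions jordan_ring" "d \<in> L" "\<And>w. \<bar>s w - f w\<bar> \<le> d w" "\<phi> d < \<epsilon>"
proof -
  obtain \<delta>' where d': "0 < \<delta>'" "\<phi> (\<lambda>w. min (f w) \<delta>') < \<epsilon> / 2"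
    using phi_small[OF f f0, of "\<epsilon> / 2"] e by auto
  \<comment> \<open>Two slices are lost at the bottom, so the truncation estimate is needed at
    \<open>2 * \<delta>\<close>.\<close>
  define \<delta> where "\<delta> = \<delta>' / 2"
  have d: "0 < \<delta>" "\<phi> (\<lambda>w. min (f w) (2 * \<delta>)) < \<epsilon> / 2" using d' by (auto simp: \<delta>_def)
  obtain M where M: "0 < M" "\<phi> f - \<phi> (\<lambda>w. min (f w) M) < \<epsilon> / 2"
    using phi_large[OF f f0, of "\<epsilon> / 2"] e by auto
  obtain N :: nat where N: "M < real N * \<delta>" using reals_Archimedean3[OF d(1)] by blast
  \<comment> \<open>The lower level starts at \<delta> and not at 0, since good levels are available
    only above 0. Consequently \<open>E i\<close> is bounded above by the slice from
    \<open>i * \<delta>\<close> and below by the slice from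
    \<open>(i + 2) * \<delta>\<close>.\<close>
  have "\<exists>E. E \<in> jordan_ring \<and> {w. real (i + 2) * \<delta> \<le> f w} \<subseteq> E \<and> E \<subseteq> {w. real (i + 1) * \<delta> < f w}" for i
  proof -
    have "0 < real (i + 1) * \<delta>" "real (i + 1) * \<delta> < real (i + 2) * \<delta>" using d(1) by simp_all
    from jordan_between[OF f f0 this] show ?thesis by metis
  qed
  then obtain E where E: "\<And>i. E i \<in> jordan_ring" "\<And>i. {w. real (i + 2) * \<delta> \<le> f w} \<subseteq> E i"
    "\<And>i. E i \<subseteq> {w. real (i + 1) * \<delta> < f w}" by metis
  define s where "s = (\<lambda>w. \<Sum>i<N. \<delta> * indicat_real (E i) w)"
  have s: "s \<in> simple_functions jordan_ring"
    unfolding simple_functions_def s_def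
    using E(1) by (intro CollectI exI[of _ N] exI[of _ "\<lambda>i. \<delta>"] exI[of _ E]) simp
  have up: "\<delta> * indicat_real (E i) w \<le> min (f w) (real (i + 1) * \<delta>) - min (f w) (real i * \<delta>)" for i w
    using E(3)[of i] d(1) by (auto simp: indicator_def min_def algebra_simps)
  have lo: "min (f w) (real (i + 3) * \<delta>) - min (f w) (real (i + 2) * \<delta>) \<le> \<delta> * indicat_real (E i) w" for i w
  proof (cases "w \<in> E i")
    case False
    then have "f w < real (i + 2) * \<delta>" using E(2)[of i] by force
    moreover have "real (i + 2) * \<delta> \<le> real (i + 3) * \<delta>" using d(1) by simp
    ultimately show ?thesis using False by (simp add: min_def)
  qed (use d(1) in \<open>auto simp: min_def algebra_simps\<close>)
  have sf: "s w \<le> f w" for w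
  proof -
    have "s w \<le> (\<Sum>i<N. min (f w) (real (Suc i) * \<delta>) - min (f w) (real i * \<delta>))"
      unfolding s_def using up by (intro sum_mono) simp
    also have "\<dots> = min (f w) (real N * \<delta>) - min (f w) 0"
      by (subst sum_lessThan_telescope) simp
    finally show ?thesis using f0[of w] by auto
  qed
  have fs: "min (f w) M - min (f w) (2 * \<delta>) \<le> s w" for w
  proof -
    have "(\<Sum>i<N. min (f w) (real (Suc i + 2) * \<delta>) - min (f w) (real (i + 2) * \<delta>)) \<le> s w"
      unfolding s_def using lo by (intro sum_mono) (simp add: add.commute)
    moreover have "(\<Sum>i<N. min (f w) (real (Suc i + 2) * \<delta>) - min (f w) (real (i + 2) * \<delta>))
        = min (f w) (real (N + 2) * \<delta>) - min (f w) (real (0 + 2) * \<delta>)"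
      by (rule sum_lessThan_telescope)
    moreover have "min (f w) M \<le> min (f w) (real (N + 2) * \<delta>)"
      using N d(1) by (intro min.mono order_refl) (simp add: algebra_simps)
    ultimately show ?thesis by simp
  qed
  note m = min_const_in[OF f, of M] min_const_in[OF f, of "2 * \<delta>"]
  have D: "(\<lambda>w. f w - min (f w) M + min (f w) (2 * \<delta>)) \<in> L"
    using m M(1) d(1) f by (intro add_in diff_in) auto
  show ?thesis
  proof (rule that[OF s D])
    show "\<bar>s w - f w\<bar> \<le> f w - min (f w) M + min (f w) (2 * \<delta>)" for w
      using sf[of w] fs[of w] by linarith
    show "\<phi> (\<lambda>w. f w - min (f w) M + min (f w) (2 * \<delta>)) < \<epsilon>"
      using phi_add[OF diff_in[OF f m(1)] m(2)] phi_diff[OF f m(1)] M d by simp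
  qed
qed

text \<open>The dominating functions \<open>d n\<close> control everything at once: their values
  under \<phi> bound the distance in measure, the mutual distances of the simple functions in mean,
  and the distance of their integrals from \<phi> f.\<close>

lemma L1_nonneg:
  assumes f: "f \<in> L" and f0: "\<And>w. 0 \<le> f w"
  shows "f \<in> L1 jordan_ring jordan_content" "fa_integral jordan_ring jordan_content f = \<phi> f"
proof -
  have "\<exists>s d. s \<in> simple_functions jordan_ring \<and> d \<in> L \<and> (\<forall>w. \<bar>s w - f w\<bar> \<le> d w) \<and> \<phi> d < 1 / real (Suc n)" for n
    using simple_sandwich[OF f f0, of "1 / real (Suc n)"] by (metis zero_less_divide_1_iff of_nat_0_less_iff zero_less_Suc)
  then obtain s d where s: "\<And>n. s n \<in> simple_functions jordan_ring" and d: "\<And>n. d n \<in> L"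
    and sd: "\<And>n w. \<bar>s n w - f w\<bar> \<le> d n w" and small: "\<And>n. \<phi> (d n) < 1 / real (Suc n)" by metis
  have d0: "0 \<le> d n w" for n w using sd[of n w] by linarith
  have pd0: "0 \<le> \<phi> (d n)" for n using phi_nonneg[OF d d0] .
  have lim: "(\<lambda>n. \<phi> (d n)) \<longlonglongrightarrow> 0"
    using small pd0 by (intro real_tendsto_sandwich[OF _ _ tendsto_const LIMSEQ_inverse_real_of_nat])
      (auto intro!: always_eventually less_imp_le simp: inverse_eq_divide)
  have ev: "\<exists>N. \<forall>n\<ge>N. \<phi> (d n) < \<epsilon>" if "0 < \<epsilon>" for \<epsilon>
    using order_tendstoD(2)[OF lim that] by (simp add: eventually_sequentially)
  have app: "approximating jordan_ring jordan_content f s"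
    unfolding approximating_def converges_iff
  proof (intro conjI allI impI)
    fix \<epsilon> :: real assume e: "0 < \<epsilon>"
    show "\<exists>N. \<forall>n\<ge>N. \<exists>B\<in>jordan_ring. {w. c < \<bar>s n w - f w\<bar>} \<subseteq> B \<and> jordan_content B < \<epsilon>"
      if c: "0 < c" for c
    proof -
      obtain N where N: "\<forall>n\<ge>N. \<phi> (d n) < \<epsilon> * c / 2" using ev[of "\<epsilon> * c / 2"] c e by auto
      have "\<exists>B\<in>jordan_ring. {w. c < \<bar>s n w - f w\<bar>} \<subseteq> B \<and> jordan_content B < \<epsilon>" if n: "n \<ge> N" for n
      proof -
        \<comment> \<open>Lowering the level to \<open>c / 2\<close> makes room for a Jordan set;
          its indicator is still at most \<open>2 / c * d n\<close>.\<close>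
        obtain B where B: "B \<in> jordan_ring" "{w. c \<le> d n w} \<subseteq> B" "B \<subseteq> {w. c / 2 < d n w}"
          using jordan_between[OF d d0, of "c / 2" c] c by auto
        have "jordan_content B \<le> \<phi> (\<lambda>w. 2 / c * d n w)"
          using B(3) c d0[of n] by (intro content_le cmult_in d) (auto simp: indicator_def field_simps)
        also have "\<dots> = 2 / c * \<phi> (d n)" by (rule phi_cmult[OF d])
        also have "\<dots> < 2 / c * (\<epsilon> * c / 2)" using N n c by (intro mult_strict_left_mono) auto
        also have "\<dots> = \<epsilon>" using c by simp
        finally have "jordan_content B < \<epsilon>" .
        moreover have "{w. c < \<bar>s n w - f w\<bar>} \<subseteq> B"
        proof
          fix w assume "w \<in> {w. c < \<bar>s n w - f w\<bar>}"
          then have "c \<le> d n w" using sd[of n w] by simp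
          then show "w \<in> B" using B(2) by blast
        qed
        ultimately show ?thesis using B(1) by blast
      qed
      then show ?thesis by blast
    qed
    obtain N where N: "\<forall>n\<ge>N. \<phi> (d n) < \<epsilon> / 2" using ev[of "\<epsilon> / 2"] e by auto
    have "simple_int jordan_content (\<lambda>w. \<bar>s n w - s k w\<bar>) < \<epsilon>" if nk: "n \<ge> N" "k \<ge> N" for n k
    proof -
      have "simple_int jordan_content (\<lambda>w. \<bar>s n w - s k w\<bar>) \<le> \<phi> (\<lambda>w. d n w + d k w)"
      proof (rule simple_int_le_phi[OF simple_abs_diff[OF s s] add_in[OF d d]])
        show "\<bar>s n w - s k w\<bar> \<le> d n w + d k w" for w using sd[of n w] sd[of k w] by linarith
      qed
      also have "\<dots> = \<phi> (d n) + \<phi> (d k)" by (rule phi_add[OF d d])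
      also have "\<dots> < \<epsilon> / 2 + \<epsilon> / 2" using N nk by (intro add_strict_mono) auto
      finally show ?thesis by simp
    qed
    then show "\<exists>N. \<forall>n\<ge>N. \<forall>k\<ge>N. simple_int jordan_content (\<lambda>w. \<bar>s n w - s k w\<bar>) < \<epsilon>" by blast
  qed (rule s)
  then show "f \<in> L1 jordan_ring jordan_content" by (rule L1I)
  have "(\<lambda>n. simple_int jordan_content (s n) - \<phi> f) \<longlonglongrightarrow> 0"
  proof (rule Lim_null_comparison[OF always_eventually lim], rule allI)
    fix n
    have "simple_int jordan_content (s n) \<le> \<phi> (\<lambda>w. f w + d n w)"
    proof (rule simple_int_le_phi[OF s add_in[OF f d]])
      show "s n w \<le> f w + d n w" for w using sd[of n w] by linarith
    qed
    moreover have "\<phi> (\<lambda>w. f w - d n w) \<le> simple_int jordan_content (s n)"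
    proof (rule phi_le_simple_int[OF s diff_in[OF f d]])
      show "f w - d n w \<le> s n w" for w using sd[of n w] by linarith
    qed
    ultimately show "norm (simple_int jordan_content (s n) - \<phi> f) \<le> \<phi> (d n)"
      using phi_add[OF f d[of n]] phi_diff[OF f d[of n]] by (simp add: abs_le_iff)
  qed
  then have "(\<lambda>n. simple_int jordan_content (s n)) \<longlonglongrightarrow> \<phi> f"
    by (simp add: LIM_zero_iff)
  then show "fa_integral jordan_ring jordan_content f = \<phi> f"
    using approximating_integral[OF app] LIMSEQ_unique by blast
qed

lemma L1_jordan:
  assumes f: "f \<in> L"
  shows "f \<in> L1 jordan_ring jordan_content" "fa_integral jordan_ring jordan_content f = \<phi> f"
proof -
  note p = pos_in[OF f] and q = pos_in[OF cmult_in[OF f, of "- 1"]]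
  note p' = L1_nonneg[OF p] and q' = L1_nonneg[OF q]
  have eq: "(\<lambda>w. max (f w) 0 - max (- 1 * f w) 0) = f" by (auto simp: max_def)
  show "f \<in> L1 jordan_ring jordan_content" using L1_diff[OF p'(1) q'(1)] by (simp only: eq)
  show "fa_integral jordan_ring jordan_content f = \<phi> f"
    using integral_diff[OF p'(1) q'(1)] phi_diff[OF p q] p'(2) q'(2) by (simp only: eq)
qed

lemma jordan_le:
  assumes x: "measure_structure \<B> x"
    and rep: "\<And>f. f \<in> L \<Longrightarrow> f \<in> L1 \<B> x \<and> fa_integral \<B> x f = \<phi> f"
  shows "struct_le jordan_ring jordan_content \<B> x"
proof -
  interpret B: finadd \<B> x by unfold_locales (rule x)
  have "E \<in> completion_ring \<B> x \<and> extension \<B> x E = jordan_content E" if E: "E \<in> jordan_ring" for E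
    unfolding B.completion_iff
  proof (intro allI impI)
    fix \<epsilon> :: real assume e: "0 < \<epsilon>"
    obtain g f where gf: "g \<in> L" "f \<in> L" "\<And>w. 0 \<le> g w" "\<And>w. g w \<le> indicat_real E w"
      "\<And>w. indicat_real E w \<le> f w" "jordan_content E - \<epsilon> / 2 < \<phi> g" "\<phi> f < jordan_content E + \<epsilon> / 2"
      using jordan_approx[OF E, of "\<epsilon> / 2"] e by (metis half_gt_zero)
    have "0 \<le> f w" for w using gf(3-5)[of w] by linarith
    moreover have "1 \<le> f w" if "w \<in> E" for w using gf(5)[of w] that by simp
    ultimately obtain C where C: "C \<in> \<B>" "E \<subseteq> C" "x C < \<phi> f + \<epsilon> / 2"
      using B.outer_approx[of f E "\<epsilon> / 2"] rep[OF gf(2)] e by (metis half_gt_zero)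
    have "g w \<le> 1" for w using gf(4)[of w] by (auto simp: indicator_def split: if_splits intro: order_trans)
    moreover have "g w = 0" if "w \<notin> E" for w using gf(3,4)[of w] that by simp
    ultimately obtain A where A: "A \<in> \<B>" "A \<subseteq> E" "\<phi> g - \<epsilon> / 2 < x A"
      using B.inner_approx[of g E "\<epsilon> / 2"] rep[OF gf(1)] gf(3) e by (metis half_gt_zero)
    show "\<exists>A\<in>\<B>. \<exists>B\<in>\<B>. A \<subseteq> E \<and> E \<subseteq> B \<and> jordan_content E - \<epsilon> < x A \<and> x B < jordan_content E + \<epsilon>"
      using A C gf(6,7) by (intro bexI[of _ A] bexI[of _ C]) auto
  qed
  then show ?thesis by (auto simp: struct_le_def)
qed

text \<open>The Jordan ring is its own completion: a set squeezed by Jordan sets is squeezed by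
  members of \<open>L\<close>. A structure below it is therefore literally a restriction of it, so
  countable additivity can be inherited.\<close>

lemma jordan_complete:
  assumes "struct_le \<B> x jordan_ring jordan_content" "E \<in> \<B>"
  shows "E \<in> jordan_ring" "jordan_content E = x E"
proof -
  have c: "E \<in> completion_ring jordan_ring jordan_content \<and> extension jordan_ring jordan_content E = x E"
    using assms by (auto simp: struct_le_def)
  have *: "\<exists>g\<in>L. \<exists>f\<in>L. (\<forall>w. g w \<le> indicat_real E w \<and> indicat_real E w \<le> f w)
      \<and> x E - \<epsilon> < \<phi> g \<and> \<phi> f < x E + \<epsilon>" if e: "0 < \<epsilon>" for \<epsilon>
  proof -
    obtain A B where AB: "A \<in> jordan_ring" "B \<in> jordan_ring" "A \<subseteq> E" "E \<subseteq> B"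
      "x E - \<epsilon> / 2 < jordan_content A" "jordan_content B < x E + \<epsilon> / 2"
      using c e unfolding completion_iff by (meson half_gt_zero)
    obtain g where g: "g \<in> L" "\<And>w. g w \<le> indicat_real A w" "jordan_content A - \<epsilon> / 2 < \<phi> g"
      using jordan_approx[OF AB(1), of "\<epsilon> / 2"] e by (metis half_gt_zero)
    obtain f where f: "f \<in> L" "\<And>w. indicat_real B w \<le> f w" "\<phi> f < jordan_content B + \<epsilon> / 2"
      using jordan_approx[OF AB(2), of "\<epsilon> / 2"] e by (metis half_gt_zero)
    have "indicat_real A w \<le> indicat_real E w" "indicat_real E w \<le> indicat_real B w" for w
      using AB by (auto simp: indicator_def)
    then show ?thesis
      using g f AB order_trans[OF g(2)] order_trans[OF _ f(2)]
      by (intro bexI[of _ g] bexI[of _ f]) auto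
  qed
  show "E \<in> jordan_ring" "jordan_content E = x E" using jordanI[OF *] by auto
qed

text \<open>The remainders \<open>D n\<close> decrease to the empty set, and their contents must
  tend to 0. Minorants \<open>g n\<close> of nearly full value need not decrease; their running
  minima \<open>k n\<close> do, and lose less than \<epsilon> / 2 in total. A small \<phi> (k n)
  then forces a small content of \<open>D n\<close>.\<close>

lemma jordan_countably_additive:
  assumes cont: "\<And>k \<epsilon>. \<lbrakk>\<And>n. k n \<in> L; \<And>n w. 0 \<le> k n w; \<And>n w. k n w \<le> 1; \<And>n w. k (Suc n) w \<le> k n w;
    \<And>w. \<exists>n. k n w = 0; 0 < \<epsilon>\<rbrakk> \<Longrightarrow> \<exists>n::nat. \<phi> (k n) < \<epsilon>"
  shows "is_countably_additive jordan_ring jordan_content"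
  unfolding is_countably_additive_def
proof (intro allI impI)
  fix E :: "nat \<Rightarrow> 'b set"
  assume E: "range E \<subseteq> jordan_ring" "disjoint_family E" "(\<Union>n. E n) \<in> jordan_ring"
  define U where "U = (\<Union>n. E n)"
  define D where "D = (\<lambda>n. U - (\<Union>i<n. E i))"
  have P: "(\<Union>i<n. E i) \<in> jordan_ring" "jordan_content (\<Union>i<n. E i) = (\<Sum>i<n. jordan_content (E i))" for n
  proof -
    have "disjoint_family_on E {..<n}" using E(2) by (auto simp: disjoint_family_on_def)
    then show "(\<Union>i<n. E i) \<in> jordan_ring" "jordan_content (\<Union>i<n. E i) = (\<Sum>i<n. jordan_content (E i))"
      using sum_disjoint[of "{..<n}" E] E(1) by auto
  qed
  have D: "D n \<in> jordan_ring" for n using E(3) P by (auto simp: D_def U_def)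
  have dec: "D (Suc n) \<subseteq> D n" for n by (auto simp: D_def)
  have split: "(\<Sum>i<n. jordan_content (E i)) = jordan_content U - jordan_content (D n)" for n
  proof -
    have "U = (\<Union>i<n. E i) \<union> D n" by (auto simp: D_def U_def)
    moreover have "jordan_content ((\<Union>i<n. E i) \<union> D n) = jordan_content (\<Union>i<n. E i) + jordan_content (D n)"
      by (rule add_disjoint[OF P(1) D]) (auto simp: D_def)
    ultimately show ?thesis using P(2)[of n] by simp
  qed
  have small: "\<exists>n. jordan_content (D n) < \<epsilon>" if e: "0 < \<epsilon>" for \<epsilon>
  proof -
    have "\<exists>g. g \<in> L \<and> (\<forall>w. 0 \<le> g w \<and> g w \<le> indicat_real (D n) w)
        \<and> jordan_content (D n) - \<epsilon> / 2 ^ (n + 2) < \<phi> g" for n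
    proof -
      \<comment> \<open>These errors add up to \<open>\<epsilon> * (1 / 2 - 1 / 2 ^ (n + 2))\<close>
        up to index \<open>n\<close>, which is the loss stated in \<open>lower\<close>.\<close>
      have "0 < \<epsilon> / 2 ^ (n + 2)" using e by simp
      from jordan_approx[OF D this] show ?thesis by metis
    qed
    then obtain g where g: "\<And>n. g n \<in> L" "\<And>n w. 0 \<le> g n w" "\<And>n w. g n w \<le> indicat_real (D n) w"
      "\<And>n. jordan_content (D n) - \<epsilon> / 2 ^ (n + 2) < \<phi> (g n)" by metis
    define k where "k = rec_nat (g 0) (\<lambda>n p w. min (p w) (g (Suc n) w))"
    have k0: "k 0 = g 0" and kS: "k (Suc n) = (\<lambda>w. min (k n w) (g (Suc n) w))" for n
      by (auto simp: k_def)
    have kL: "k n \<in> L" for n by (induction n) (auto simp: k0 kS g(1) min_in)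
    have kp: "0 \<le> k n w" for n w by (induction n) (auto simp: k0 kS g(2))
    have kg: "k n w \<le> g n w" for n w by (cases n) (auto simp: k0 kS)
    have kD: "k n w \<le> indicat_real (D n) w" for n w using kg g(3) order_trans by blast
    have lower: "jordan_content (D n) - \<epsilon> * (1 / 2 - 1 / 2 ^ (n + 2)) < \<phi> (k n)" for n
    proof (induction n)
      case 0
      then show ?case using g(4)[of 0] by (simp add: k0)
    next
      case (Suc n)
      \<comment> \<open>A minimum is the sum less the maximum. The maximum is still a minorant of
        \<open>D n\<close>, so passing to the minimum adds only the error of
        \<open>g (Suc n)\<close> to the accumulated loss.\<close>
      have eq: "k (Suc n) = (\<lambda>w. k n w + g (Suc n) w - max (k n w) (g (Suc n) w))"
        by (auto simp: kS min_def max_def)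
      have M: "(\<lambda>w. max (k n w) (g (Suc n) w)) \<in> L" by (intro max_in kL g)
      obtain f where f: "f \<in> L" "\<And>w. indicat_real (D n) w \<le> f w"
        using jordan_approx[OF D zero_less_one] by metis
      have "max (k n w) (g (Suc n) w) \<le> indicat_real (D n) w" for w
      proof -
        have "indicat_real (D (Suc n)) w \<le> indicat_real (D n) w"
          using dec by (auto simp: indicator_def)
        then show ?thesis using kD[of n w] g(3)[of "Suc n" w] by simp
      qed
      from content_ge[OF f M this]
      have "\<phi> (\<lambda>w. max (k n w) (g (Suc n) w)) \<le> jordan_content (D n)" .
      moreover have "\<phi> (k (Suc n)) = \<phi> (k n) + \<phi> (g (Suc n)) - \<phi> (\<lambda>w. max (k n w) (g (Suc n) w))"
        unfolding eq using phi_diff[OF add_in[OF kL g(1)] M] phi_add[OF kL g(1)] by simp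
      moreover note Suc.IH g(4)[of "Suc n"]
      moreover have "\<epsilon> * (1 / 2 - 1 / 2 ^ (n + 2)) + \<epsilon> / 2 ^ (Suc n + 2) = \<epsilon> * (1 / 2 - 1 / 2 ^ (Suc n + 2))"
        by (simp add: field_simps)
      ultimately show ?case by linarith
    qed
    have "\<exists>n. \<phi> (k n) < \<epsilon> / 2"
    proof (rule cont)
      show "k n w \<le> 1" for n w
        using order_trans[OF kD indicator_le_1] by blast
      show "\<exists>n. k n w = 0" for w
      proof -
        have "\<exists>n. w \<notin> D n"
        proof (cases "w \<in> U")
          case True
          then obtain i where "w \<in> E i" by (auto simp: U_def)
          then have "w \<notin> D (Suc i)" by (auto simp: D_def)
          then show ?thesis by blast
        qed (simp add: D_def)
        then obtain n where "w \<notin> D n" by blast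
        then show ?thesis using kD[of n w] kp[of n w] by (intro exI[of _ n]) simp
      qed
    qed (use kL kp kS e in auto)
    then obtain n where n: "\<phi> (k n) < \<epsilon> / 2" by blast
    have "\<epsilon> * (1 / 2 - 1 / 2 ^ (n + 2)) \<le> \<epsilon> * (1 / 2)" using e by (intro mult_left_mono) auto
    with lower[of n] n have "jordan_content (D n) < \<epsilon>" by linarith
    then show ?thesis by blast
  qed
  have "(\<lambda>n. jordan_content (D n)) \<longlonglongrightarrow> 0"
  proof (rule LIMSEQ_I)
    fix r :: real assume "0 < r"
    then obtain N where N: "jordan_content (D N) < r" using small by blast
    have "jordan_content (D n) < r" if "n \<ge> N" for n
    proof -
      have "D n \<subseteq> D N" using that by (auto simp: D_def)
      then show ?thesis using mono_l[OF D D] N by (meson le_less_trans)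
    qed
    then show "\<exists>no. \<forall>n\<ge>no. norm (jordan_content (D n) - 0) < r"
      using nonneg[OF D] by auto
  qed
  then have "(\<lambda>n. jordan_content U - jordan_content (D n)) \<longlonglongrightarrow> jordan_content U - 0"
    by (intro tendsto_diff tendsto_const)
  then show "(\<lambda>n. jordan_content (E n)) sums jordan_content (\<Union>n. E n)"
    unfolding sums_def split U_def[symmetric] by simp
qed

end


section \<open>Representation\<close>

lemma le_inf_on_imageI: "(\<And>w. c \<le> h (X' w)) \<Longrightarrow> ereal c \<le> inf_on_image h X'"
  unfolding inf_on_image_def by (intro INF_greatest) simp

lemma less_inf_on_image: "ereal c < inf_on_image h X' \<Longrightarrow> c < h (X' w)"
  unfolding inf_on_image_def by (metis INF_lower UNIV_I less_ereal.simps(1) less_le_trans)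

lemma inf_on_image_less_0_iff: "inf_on_image h X' < 0 \<longleftrightarrow> (\<exists>w. h (X' w) < 0)"
  by (auto simp: inf_on_image_def INF_less_iff)

locale representation = base: finadd \<A> m
  for \<A> :: "'a set set" and m :: "'a set \<Rightarrow> real" +
  fixes X :: "'a \<Rightarrow> 's" and X' :: "'b \<Rightarrow> 's" and H :: "('s \<Rightarrow> real) set"
  assumes sublattice: "vector_sublattice H" and stonean: "stonean H"
begin

definition V :: "('s \<Rightarrow> real) set" where
  "V = integrable_part H \<A> m X"

definition I :: "('s \<Rightarrow> real) \<Rightarrow> real" where
  "I h = fa_integral \<A> m (\<lambda>w. h (X w))"

lemma V_L1: "h \<in> V \<Longrightarrow> (\<lambda>w. h (X w)) \<in> L1 \<A> m" and V_H: "h \<in> V \<Longrightarrow> h \<in> H"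
  by (auto simp: V_def integrable_part_def)

lemma V_zero: "(\<lambda>s. 0) \<in> V"
  using sublattice base.simple_L1[OF base.simple_zero]
  by (simp add: V_def integrable_part_def vector_sublattice_def)

lemma V_add: "\<lbrakk>f \<in> V; g \<in> V\<rbrakk> \<Longrightarrow> (\<lambda>s. f s + g s) \<in> V"
  and I_add: "\<lbrakk>f \<in> V; g \<in> V\<rbrakk> \<Longrightarrow> I (\<lambda>s. f s + g s) = I f + I g"
  and V_cmult: "f \<in> V \<Longrightarrow> (\<lambda>s. c * f s) \<in> V"
  and I_cmult: "f \<in> V \<Longrightarrow> I (\<lambda>s. c * f s) = c * I f"
  and V_max: "\<lbrakk>f \<in> V; g \<in> V\<rbrakk> \<Longrightarrow> (\<lambda>s. max (f s) (g s)) \<in> V"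
  and V_min: "\<lbrakk>f \<in> V; g \<in> V\<rbrakk> \<Longrightarrow> (\<lambda>s. min (f s) (g s)) \<in> V"
  and V_min_one: "f \<in> V \<Longrightarrow> (\<lambda>s. min (f s) 1) \<in> V"
  using sublattice stonean base.L1_min_const[of _ 1]
  by (simp_all add: V_def I_def integrable_part_def vector_sublattice_def stonean_def
      base.L1_add base.L1_cmult base.L1_max base.L1_min base.integral_add base.integral_cmult)

lemma V_diff: "\<lbrakk>f \<in> V; g \<in> V\<rbrakk> \<Longrightarrow> (\<lambda>s. f s - g s) \<in> V"
  and I_diff: "\<lbrakk>f \<in> V; g \<in> V\<rbrakk> \<Longrightarrow> I (\<lambda>s. f s - g s) = I f - I g"
  using V_add[OF _ V_cmult[of g "- 1"], of f] I_add[OF _ V_cmult[of g "- 1"], of f]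
    I_cmult[of g "- 1"] by auto

lemma V_min_const:
  assumes "f \<in> V" "0 < c"
  shows "(\<lambda>s. min (f s) c) \<in> V"
proof -
  have "(\<lambda>s. c * min (1 / c * f s) 1) = (\<lambda>s. min (f s) c)"
    using assms(2) by (auto simp: min_def field_simps)
  then show ?thesis using V_cmult[OF V_min_one[OF V_cmult[OF assms(1)]], of c "1 / c"] by simp
qed

lemma V_pos: "f \<in> V \<Longrightarrow> (\<lambda>s. max (f s) 0) \<in> V"
  using V_max[OF _ V_zero] by simp

lemma I_mono: "\<lbrakk>f \<in> V; g \<in> V; \<And>s. f s \<le> g s\<rbrakk> \<Longrightarrow> I f \<le> I g"
  unfolding I_def by (intro base.integral_mono V_L1)

definition compatible :: bool where
  "compatible \<longleftrightarrow> (\<forall>h\<in>V. I h < 0 \<longrightarrow> (\<exists>w. h (X' w) < 0))"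

lemma represents_compatible:
  assumes "measure_structure \<B> x" "represents H \<A> m X X' \<B> x"
  shows compatible
  unfolding compatible_def
proof (intro ballI impI)
  interpret B: finadd \<B> x by unfold_locales fact
  fix h assume h: "h \<in> V" "I h < 0"
  have "(\<lambda>w. h (X' w)) \<in> L1 \<B> x" "fa_integral \<B> x (\<lambda>w. h (X' w)) < 0"
    using assms(2) h by (auto simp: represents_def V_def I_def)
  then show "\<exists>w. h (X' w) < 0" using B.integral_nonneg by (meson not_less)
qed

section \<open>Total mass of a representing structure\<close>

definition dominates_inf :: bool where
  "dominates_inf \<longleftrightarrow> (\<forall>h\<in>V. inf_on_image h X' \<le> ereal (I h))"

lemma dominates_infD: "\<lbrakk>dominates_inf; h \<in> V; \<And>w. c \<le> h (X' w)\<rbrakk> \<Longrightarrow> c \<le> I h"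
  using le_inf_on_imageI[of c h X'] unfolding dominates_inf_def by (metis ereal_less_eq(3) order_trans)

lemma probability_dominates_inf:
  assumes "measure_structure \<B> x" "represents H \<A> m X X' \<B> x" "is_probability \<B> x"
  shows dominates_inf
  unfolding dominates_inf_def
proof
  interpret B: finadd \<B> x by unfold_locales fact
  fix h assume h: "h \<in> V"
  show "inf_on_image h X' \<le> ereal (I h)"
  proof (rule ccontr)
    assume "\<not> inf_on_image h X' \<le> ereal (I h)"
    \<comment> \<open>The infimum may be infinite, so a real number in between is used as the lower
      bound.\<close>
    then obtain c where c: "ereal (I h) < ereal c" "ereal c < inf_on_image h X'"
      using ereal_dense2 by (metis not_le)
    have "(\<lambda>w. h (X' w)) \<in> L1 \<B> x" and eq: "fa_integral \<B> x (\<lambda>w. h (X' w)) = I h"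
      using assms(2) h by (auto simp: represents_def V_def I_def)
    then have "c \<le> fa_integral \<B> x (\<lambda>w. h (X' w))"
      using B.probability_integral_ge[OF assms(3)] less_inf_on_image[OF c(2)] by (meson less_imp_le)
    with eq c(1) show False by simp
  qed
qed

text \<open>A function with a positive lower bound on the image, rescaled and cut at 1, becomes the
  constant 1 there. The constant is then integrable, and the inequality applied to it and to its
  negative forces its integral to be 1; this determines the total mass.\<close>

lemma dominates_inf_probability:
  assumes "measure_structure \<B> x" "represents H \<A> m X X' \<B> x" dominates_inf
    and h: "h \<in> V" "0 < inf_on_image h X'"
  shows "is_probability \<B> x"
proof -
  interpret B: finadd \<B> x by unfold_locales fact
  obtain c where c: "0 < ereal c" "ereal c < inf_on_image h X'"
    using ereal_dense2[OF h(2)] by blast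
  define g where "g = (\<lambda>s. min (1 / c * h s) 1)"
  have g: "g \<in> V" unfolding g_def by (intro V_min_one V_cmult h)
  have g1: "g (X' w) = 1" for w
    using less_inf_on_image[OF c(2), of w] c(1) by (simp add: g_def field_simps)
  have "1 \<le> I g" "- 1 \<le> I (\<lambda>s. - 1 * g s)"
    using dominates_infD[OF assms(3)] g V_cmult[OF g] g1 by (metis order_refl mult_1_right)+
  then have "I g = 1" using I_cmult[OF g, of "- 1"] by simp
  moreover have "(\<lambda>w. g (X' w)) \<in> L1 \<B> x \<and> fa_integral \<B> x (\<lambda>w. g (X' w)) = I g"
    using assms(2) g by (auto simp: represents_def V_def I_def)
  ultimately have one: "(\<lambda>w. 1) \<in> L1 \<B> x" "fa_integral \<B> x (\<lambda>w. 1) = 1" by (simp_all add: g1)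
  have "x E \<le> 1" if "E \<in> \<B>" for E
    using B.integral_mono[OF B.simple_L1[OF B.simple_indicator[OF that]] one(1)] one(2)
      B.integral_simple[OF B.simple_indicator[OF that]] B.simple_int_indicator[OF that]
    by (simp add: indicator_def)
  moreover have "\<exists>E\<in>\<B>. 1 - \<epsilon> < x E" if "0 < \<epsilon>" for \<epsilon>
  proof (rule ccontr)
    assume "\<not> (\<exists>E\<in>\<B>. 1 - \<epsilon> < x E)"
    then have "fa_integral \<B> x (\<lambda>w. 1) \<le> 1 * (1 - \<epsilon>)"
      by (intro B.integral_le_bound one) auto
    with one(2) that show False by simp
  qed
  ultimately show ?thesis by (simp add: B.is_probability_iff)
qed

section \<open>The positive functional induced on functions of \<open>X'\<close>\<close>

definition L :: "('b \<Rightarrow> real) set" where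
  "L = (\<lambda>h w. h (X' w)) ` V"

definition phi :: "('b \<Rightarrow> real) \<Rightarrow> real" where
  "phi f = I (SOME h. h \<in> V \<and> (\<lambda>w. h (X' w)) = f)"

lemma L_I: "h \<in> V \<Longrightarrow> (\<lambda>w. h (X' w)) \<in> L"
  by (auto simp: L_def)

lemma L_E:
  assumes "f \<in> L"
  obtains h where "h \<in> V" "f = (\<lambda>w. h (X' w))"
  using assms by (auto simp: L_def)

lemma compatible_nonneg:
  assumes compatible "h \<in> V" "\<And>w. 0 \<le> h (X' w)"
  shows "0 \<le> I h"
  using assms by (meson compatible_def not_less)

text \<open>Two representatives agree on the image, so both of their differences are nonnegative
  there and have nonnegative integrals. The choice in \<open>phi\<close> is thus immaterial.\<close>

lemma phi_eq:
  assumes compatible "h \<in> V"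
  shows "phi (\<lambda>w. h (X' w)) = I h"
proof -
  define k where "k = (SOME k. k \<in> V \<and> (\<lambda>w. k (X' w)) = (\<lambda>w. h (X' w)))"
  have "k \<in> V \<and> (\<lambda>w. k (X' w)) = (\<lambda>w. h (X' w))"
    unfolding k_def by (rule someI[of _ h]) (simp add: assms)
  then have k: "k \<in> V" "\<And>w. k (X' w) = h (X' w)" by (auto dest: fun_cong)
  have "0 \<le> I (\<lambda>s. k s - h s)" "0 \<le> I (\<lambda>s. h s - k s)"
    using k assms by (auto intro!: compatible_nonneg V_diff)
  then show ?thesis
    using I_diff[OF k(1) assms(2)] I_diff[OF assms(2) k(1)] by (simp add: phi_def flip: k_def)
qed

lemma stone_functional:
  assumes c: compatible
  shows "stone_functional L phi"
proof
  show "(\<lambda>w. 0) \<in> L" using L_I[OF V_zero] .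
  fix f assume "f \<in> L"
  then obtain h where h: "h \<in> V" and f: "f = (\<lambda>w. h (X' w))" by (rule L_E)
  show "(\<lambda>w. a * f w) \<in> L" "phi (\<lambda>w. a * f w) = a * phi f" for a
    unfolding f using L_I[OF V_cmult[OF h]] phi_eq[OF c V_cmult[OF h]] phi_eq[OF c h] I_cmult[OF h]
    by auto
  show "(\<lambda>w. min (f w) 1) \<in> L" unfolding f using L_I[OF V_min_one[OF h]] .
  show "0 \<le> phi f" if "\<And>w. 0 \<le> f w"
    using compatible_nonneg[OF c h] phi_eq[OF c h] that by (simp add: f)
  {
    fix g assume "g \<in> L"
    then obtain k where k: "k \<in> V" and g: "g = (\<lambda>w. k (X' w))" by (rule L_E)
    show "(\<lambda>w. f w + g w) \<in> L" unfolding f g using L_I[OF V_add[OF h k]] .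
    show "phi (\<lambda>w. f w + g w) = phi f + phi g"
      unfolding f g using phi_eq[OF c V_add[OF h k]] phi_eq[OF c h] phi_eq[OF c k] I_add[OF h k] by simp
    show "(\<lambda>w. max (f w) (g w)) \<in> L" unfolding f g using L_I[OF V_max[OF h k]] .
    show "(\<lambda>w. min (f w) (g w)) \<in> L" unfolding f g using L_I[OF V_min[OF h k]] .
  }
  fix \<epsilon> :: real assume f0: "\<And>w. 0 \<le> f w" and e: "0 < \<epsilon>"
  \<comment> \<open>Nonnegativity of \<open>f\<close> says nothing about \<open>h\<close> off the
    image of \<open>X'\<close>, where \<open>X\<close> may take values. The truncation estimates on
    the side of \<open>X\<close> need a representative that is nonnegative everywhere.\<close>
  define p where "p = (\<lambda>s. max (h s) 0)"
  have p: "p \<in> V" unfolding p_def by (rule V_pos[OF h])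
  have fp: "f = (\<lambda>w. p (X' w))" using f0 by (simp add: f p_def max_absorb1)
  have p0: "0 \<le> p s" for s by (simp add: p_def)
  obtain \<delta> where "0 < \<delta>" "fa_integral \<A> m (\<lambda>w. min (p (X w)) \<delta>) < \<epsilon>"
    using base.integral_truncate_small[OF V_L1[OF p] p0 e] by blast
  then show "\<exists>\<delta>>0. phi (\<lambda>w. min (f w) \<delta>) < \<epsilon>"
    unfolding fp using phi_eq[OF c V_min_const[OF p]] by (intro exI[of _ \<delta>]) (simp add: I_def)
  obtain M where "0 < M" "fa_integral \<A> m (\<lambda>w. p (X w)) - fa_integral \<A> m (\<lambda>w. min (p (X w)) M) < \<epsilon>"
    using base.integral_truncate_large[OF V_L1[OF p] p0 e] by blast
  then show "\<exists>M>0. phi f - phi (\<lambda>w. min (f w) M) < \<epsilon>"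
    unfolding fp using phi_eq[OF c V_min_const[OF p]] phi_eq[OF c p]
    by (intro exI[of _ M]) (simp add: I_def)
qed

end

locale compatible_representation = representation +
  assumes compatible: compatible
begin

sublocale J: stone_functional L phi
  using compatible by (rule stone_functional)

abbreviation "\<J> \<equiv> J.jordan_ring"
abbreviation "\<nu> \<equiv> J.jordan_content"

lemmas phi_I = phi_eq[OF compatible]

lemma represents_iff:
  "represents H \<A> m X X' \<B> x \<longleftrightarrow> (\<forall>f\<in>L. f \<in> L1 \<B> x \<and> fa_integral \<B> x f = phi f)"
  using phi_I by (auto simp: represents_def L_def V_def I_def)

lemma represents_jordan: "represents H \<A> m X X' \<J> \<nu>"
  using J.L1_jordan by (simp add: represents_iff)

lemma minimal_jordan: "minimal_structure (represents H \<A> m X X') \<J> \<nu>"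
  unfolding minimal_structure_def represents_iff
  using J.measure_structure_jordan J.L1_jordan J.jordan_le by blast

text \<open>If some function has a positive infimum, the Jordan structure itself is a probability.
  Otherwise no member of \<open>L\<close> majorizes 1, so the whole space is not a Jordan set, and
  the missing mass can be assigned to complements without affecting any integral of
  \<open>L\<close>.\<close>

lemma probability_representation:
  assumes dom: dominates_inf
  obtains \<B> x where "measure_structure \<B> x" "represents H \<A> m X X' \<B> x" "is_probability \<B> x"
proof (cases "\<exists>h\<in>V. 0 < inf_on_image h X'")
  case True
  then show ?thesis
    using that[OF J.measure_structure_jordan represents_jordan]
      dominates_inf_probability[OF J.measure_structure_jordan represents_jordan dom] by blast
next
  case False
  have "UNIV \<notin> \<J>"
  proof
    assume "UNIV \<in> \<J>"
    then obtain f where f: "f \<in> L" "\<And>w. indicat_real UNIV w \<le> f w"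
      using J.jordan_approx[OF _ zero_less_one] by metis
    obtain h where "h \<in> V" "f = (\<lambda>w. h (X' w))" using f(1) by (rule L_E)
    then have "ereal 1 \<le> inf_on_image h X'" "h \<in> V"
      using f(2) le_inf_on_imageI[of 1 h X'] by auto
    moreover have "(0::ereal) < ereal 1" by simp
    ultimately show False using False less_le_trans by blast
  qed
  \<comment> \<open>Minorants of an indicator are at most 1 on the image; the inequality, applied to
    their negatives, bounds their values by 1.\<close>
  moreover have "\<nu> E \<le> 1" if E: "E \<in> \<J>" for E
  proof (rule field_le_epsilon)
    fix e :: real assume "0 < e"
    then obtain g where g: "g \<in> L" "\<And>w. g w \<le> indicat_real E w" "\<nu> E - e < phi g"
      using J.jordan_approx[OF E] by metis
    obtain h where h: "h \<in> V" "g = (\<lambda>w. h (X' w))" using g(1) by (rule L_E)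
    have "h (X' w) \<le> 1" for w using order_trans[OF g(2)[of w] indicator_le_1] by (simp add: h(2))
    then have "- 1 \<le> I (\<lambda>s. - 1 * h s)"
      using V_cmult[OF h(1), of "- 1"] by (intro dominates_infD[OF dom]) auto
    then show "\<nu> E \<le> 1 + e" using I_cmult[OF h(1), of "- 1"] phi_I[OF h(1)] h(2) g(3) by simp
  qed
  ultimately obtain \<B> x where B: "measure_structure \<B> x" "is_probability \<B> x" "\<J> \<subseteq> \<B>"
    "\<And>E. E \<in> \<J> \<Longrightarrow> x E = \<nu> E" using J.probability_extension by metis
  have "represents H \<A> m X X' \<B> x"
    unfolding represents_iff
    using L1_subring[OF J.finadd_axioms finadd.intro[OF B(1)] B(3,4)] J.L1_jordan by auto
  then show ?thesis using that B by blast
qed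

text \<open>The open sets where \<open>h n\<close> is below \<delta> increase with \<open>n\<close>
  and cover the image, so one of them contains its part in \<open>K\<close>. Closedness of the image
  makes that part compact; off the image the functions need not tend to 0.\<close>

lemma dini:
  assumes T: "topspace T = UNIV" "closedin T (range X')" and K: "compactin T K"
    and cont: "\<And>n. continuous_map T euclideanreal (h n)"
    and dec: "\<And>n s. h (Suc n) s \<le> h n s" and lim: "\<And>w. \<exists>n. h n (X' w) = 0" and d: "0 < \<delta>"
  obtains n :: nat where "\<And>w. X' w \<in> K \<Longrightarrow> h n (X' w) < (\<delta> :: real)"
proof -
  have KC: "compactin T (K \<inter> range X')"
    using closed_Int_compactin[OF T(2) K] by (simp add: Int_commute)
  define U where "U n = {s. h n s < \<delta>}" for n
  have "openin T (U n)" for n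
    using openin_continuous_map_preimage[OF cont, of "{..<\<delta>}" n] T(1) by (simp add: U_def)
  moreover have "K \<inter> range X' \<subseteq> \<Union> (range U)"
  proof
    fix s assume "s \<in> K \<inter> range X'"
    then obtain w where "s = X' w" by blast
    moreover obtain n where "h n (X' w) = 0" using lim by blast
    ultimately have "s \<in> U n" using d by (simp add: U_def)
    then show "s \<in> \<Union> (range U)" by blast
  qed
  ultimately obtain \<F> where F: "finite \<F>" "\<F> \<subseteq> range U" "K \<inter> range X' \<subseteq> \<Union> \<F>"
    using KC unfolding compactin_def by (metis (no_types, lifting) imageE)
  obtain N where N: "finite N" "\<F> = U ` N" using finite_subset_image[OF F(1,2)] by blast
  define n where "n = Max (insert 0 N)"
  have "U i \<subseteq> U j" if "i \<le> j" for i j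
    using lift_Suc_antimono_le[of "\<lambda>n. h n _", OF dec that]
    unfolding U_def by (blast intro: le_less_trans)
  moreover have "i \<le> n" if "i \<in> N" for i using N(1) that by (simp add: n_def)
  ultimately have "K \<inter> range X' \<subseteq> U n" using F(3) N(2) by blast
  then show ?thesis using that[of n] by (auto simp: U_def)
qed

text \<open>All three cases fix a compact set and let Dini push \<open>k n\<close> below \<delta>
  over it, where \<phi> of the truncated \<open>k 0\<close> already bounds the value. They differ in
  why the rest is negligible: (i) nothing lives off the support, (ii) the rest has small content for
  \<open>\<nu>\<close>, (iii) it has small content for \<open>m\<close>.\<close>

lemma countably_additive_jordan:
  assumes T: "topspace T = UNIV" "closedin T (range X')"
    and cont: "\<And>h. h \<in> H \<Longrightarrow> continuous_map T euclideanreal h"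
    and alt: "(\<forall>h\<in>H. compact_support T h) \<or> tight \<J> \<nu> T X' \<or>
      (tight \<A> m T X \<and> inner_val \<A> m {w. X w \<notin> range X'} = 0)"
  shows "is_countably_additive \<J> \<nu>"
proof (rule J.jordan_countably_additive)
  fix k :: "nat \<Rightarrow> 'c \<Rightarrow> real" and \<epsilon> :: real
  assume k: "\<And>n. k n \<in> L" "\<And>n w. 0 \<le> k n w" "\<And>n w. k n w \<le> 1" "\<And>n w. k (Suc n) w \<le> k n w"
    "\<And>w. \<exists>n. k n w = 0" and e: "0 < \<epsilon>"
  \<comment> \<open>Cutting a representative to values between 0 and 1 on all of \<open>S\<close>
    does not change it on the image; the bounds are needed at points reached by \<open>X\<close>
    only.\<close>
  have "\<exists>h. h \<in> V \<and> k n = (\<lambda>w. h (X' w)) \<and> (\<forall>s. 0 \<le> h s \<and> h s \<le> 1)" for n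
  proof -
    obtain h where h: "h \<in> V" "k n = (\<lambda>w. h (X' w))" using k(1) by (rule L_E)
    then show ?thesis
      using V_pos[OF V_min_one[OF h(1)]] k(2,3)[of n]
      by (intro exI[of _ "\<lambda>s. max (min (h s) 1) 0"]) (simp add: max_absorb1 min_absorb1)
  qed
  then obtain g where g: "\<And>n. g n \<in> V" "\<And>n. k n = (\<lambda>w. g n (X' w))" "\<And>n s. 0 \<le> g n s"
    "\<And>n s. g n s \<le> 1" by metis
  \<comment> \<open>The lifts decrease only along the image. Running minima decrease everywhere and
    still induce \<open>k n\<close>, since \<open>k\<close> is decreasing.\<close>
  define h where "h = rec_nat (g 0) (\<lambda>n p s. min (p s) (g (Suc n) s))"
  have h0: "h 0 = g 0" and hS: "h (Suc n) = (\<lambda>s. min (h n s) (g (Suc n) s))" for n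
    by (auto simp: h_def)
  have hV: "h n \<in> V" for n by (induction n) (auto simp: h0 hS g(1) V_min)
  have hp: "0 \<le> h n s" for n s by (induction n) (auto simp: h0 hS g(3))
  have h1: "h n s \<le> 1" for n s by (induction n) (auto simp: h0 hS g(4) min.coboundedI1)
  have dec: "h (Suc n) s \<le> h n s" for n s by (simp add: hS)
  have hk: "h n (X' w) = k n w" for n w
  proof (induction n)
    case (Suc n)
    then show ?case using k(4)[of n w] g(2)[of "Suc n"] by (simp add: hS min_absorb2)
  qed (simp add: h0 g(2))
  have kdec: "k n w \<le> k 0 w" for n w
    using lift_Suc_antimono_le[of "\<lambda>n. k n w", OF k(4)] by simp
  have hdec: "h n s \<le> h 0 s" for n s
    using lift_Suc_antimono_le[of "\<lambda>n. h n s", OF dec] by simp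
  \<comment> \<open>The cut-off is fixed by \<open>k 0\<close> before \<open>n\<close> is chosen; as
    \<open>k n \<le> k 0\<close>, it serves every \<open>n\<close>.\<close>
  obtain \<delta> where d: "0 < \<delta>" "phi (\<lambda>w. min (k 0 w) \<delta>) < \<epsilon> / 2"
    using J.phi_small[OF k(1,2), of "\<epsilon> / 2"] e by auto
  have m: "(\<lambda>w. min (k n w) \<delta>) \<in> L" for n using J.min_const_in[OF k(1)] d(1) by simp
  have Dini: "\<exists>n. \<forall>w. X' w \<in> K \<longrightarrow> k n w < \<delta>" if K: "compactin T K" for K
    using dini[OF T K, of h \<delta>] cont V_H[OF hV] dec k(5) d(1) unfolding hk by metis
  have phik: "phi (k n) = I (h n)" for n
    using phi_I[OF hV[of n]] by (simp add: hk)
  from alt show "\<exists>n. phi (k n) < \<epsilon>"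
  proof (elim disjE conjE)
    assume "\<forall>h\<in>H. compact_support T h"
    then have "compactin T (T closure_of {s. h 0 s \<noteq> 0})"
      using V_H[OF hV] by (simp add: compact_support_def)
    from Dini[OF this] obtain n
      where n: "\<And>w. X' w \<in> T closure_of {s. h 0 s \<noteq> 0} \<Longrightarrow> k n w < \<delta>" by blast
    have "k n w \<le> min (k 0 w) \<delta>" for w
    proof (cases "k 0 w = 0")
      case True
      then show ?thesis using kdec[of n w] d(1) by simp
    next
      case False
      then have "X' w \<in> T closure_of {s. h 0 s \<noteq> 0}"
        using closure_of_subset[of "{s. h 0 s \<noteq> 0}" T] T(1) hk[of 0 w] by auto
      then show ?thesis using n kdec[of n w] by (simp add: less_imp_le)
    qed
    then have "phi (k n) \<le> phi (\<lambda>w. min (k 0 w) \<delta>)" by (intro J.phi_mono k m)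
    then show ?thesis using d e by (intro exI[of _ n]) simp
  next
    assume "tight \<J> \<nu> T X'"
    then obtain K where K: "compactin T K" "outer_val \<J> \<nu> {w. X' w \<notin> K} < ennreal (\<epsilon> / 4)"
      unfolding tight_def using e by (meson zero_less_divide_iff zero_less_numeral)
    obtain B where B: "B \<in> \<J>" "{w. X' w \<notin> K} \<subseteq> B" "\<nu> B < \<epsilon> / 4"
      using J.outer_less[OF K(2)] by blast
    have e4: "0 < \<epsilon> / 4" using e by simp
    \<comment> \<open>A majorant in \<open>L\<close> converts the small content of \<open>B\<close>
      into a term on which \<open>phi\<close> can be evaluated; over \<open>B\<close> it dominates
      \<open>k n\<close> because \<open>k n \<le> 1\<close>.\<close>
    obtain f where f: "f \<in> L" "\<And>w. indicat_real B w \<le> f w" "phi f < \<nu> B + \<epsilon> / 4"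
      using J.jordan_approx[OF B(1) e4] by metis
    obtain n where n: "\<And>w. X' w \<in> K \<Longrightarrow> k n w < \<delta>" using Dini[OF K(1)] by blast
    have "k n w \<le> min (k 0 w) \<delta> + f w" for w
    proof (cases "X' w \<in> K")
      case True
      have "0 \<le> f w" using order_trans[OF indicator_pos_le f(2)] .
      then show ?thesis using n[OF True] kdec[of n w] by linarith
    next
      case False
      then have "1 \<le> f w" using B(2) f(2)[of w] by auto
      then show ?thesis using k(3)[of n w] k(2)[of 0 w] d(1) by linarith
    qed
    then have "phi (k n) \<le> phi (\<lambda>w. min (k 0 w) \<delta> + f w)" by (intro J.phi_mono k m J.add_in f)
    also have "\<dots> = phi (\<lambda>w. min (k 0 w) \<delta>) + phi f" by (rule J.phi_add[OF m f(1)])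
    finally show ?thesis using d f(3) B(3) by (intro exI[of _ n]) linarith
  next
    assume tight: "tight \<A> m T X" and null: "inner_val \<A> m {w. X w \<notin> range X'} = 0"
    obtain K where K: "compactin T K" "outer_val \<A> m {w. X w \<notin> K} < ennreal (\<epsilon> / 4)"
      using tight unfolding tight_def using e by (meson zero_less_divide_iff zero_less_numeral)
    obtain A where A: "A \<in> \<A>" "{w. X w \<notin> K} \<subseteq> A" "m A < \<epsilon> / 4"
      using base.outer_less[OF K(2)] by blast
    have e4: "0 < \<epsilon> / 4" using e by simp
    obtain n where n: "\<And>w. X' w \<in> K \<Longrightarrow> k n w < \<delta>" using Dini[OF K(1)] by blast
    note mV = V_min_const[OF hV d(1)]
    \<comment> \<open>Tightness concerns \<open>m\<close>, so the excess of \<open>h n\<close> over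
      \<delta> is integrated on the side of \<open>X\<close>. It is approximated by a ring set
      inside its support, because the null condition on the complement of the image is one on inner
      content.\<close>
    define u where "u = (\<lambda>w. h n (X w) - min (h n (X w)) \<delta>)"
    have u: "u \<in> L1 \<A> m" unfolding u_def using V_L1[OF V_diff[OF hV mV]] .
    have "u w \<le> 1" for w using h1[of n "X w"] hp[of n "X w"] d(1) by (auto simp: u_def min_def)
    then obtain B where B: "B \<in> \<A>" "B \<subseteq> {w. u w \<noteq> 0}" "fa_integral \<A> m u - \<epsilon> / 4 < m B"
      using base.inner_approx[OF u _ _ _ e4, of "{w. u w \<noteq> 0}"] by (auto simp: u_def)
    \<comment> \<open>Outside \<open>A\<close> the value of \<open>X\<close> lies in
      \<open>K\<close>; if it were also in the image, Dini would give a value below \<delta> and the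
      excess would vanish.\<close>
    have "B - A \<subseteq> {w. X w \<notin> range X'}"
    proof
      fix w assume w: "w \<in> B - A"
      then have "X w \<in> K" "\<not> h n (X w) \<le> \<delta>" using A(2) B(2) by (auto simp: u_def min_def)
      then show "w \<in> {w. X w \<notin> range X'}" using n hk by (metis (mono_tags) mem_Collect_eq less_imp_le imageE)
    qed
    then have "ennreal (m (B - A)) \<le> 0"
      using base.inner_ge[OF base.Diff[OF B(1) A(1)]] null by metis
    then have "m (B - A) = 0"
      using base.nonneg[OF base.Diff[OF B(1) A(1)]] by (simp add: ennreal_eq_0_iff)
    moreover have "m B \<le> m ((B - A) \<union> A)"
      using A(1) B(1) by (intro base.mono_l base.Un base.Diff) auto
    moreover have "m ((B - A) \<union> A) \<le> m (B - A) + m A"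
      by (rule base.subadditive_l[OF base.Diff[OF B(1) A(1)] A(1)])
    ultimately have "fa_integral \<A> m u < \<epsilon> / 2" using B(3) A(3) by linarith
    moreover have "fa_integral \<A> m u = I (h n) - I (\<lambda>s. min (h n s) \<delta>)"
      using I_diff[OF hV mV] by (simp add: I_def u_def)
    moreover have "I (\<lambda>s. min (h n s) \<delta>) \<le> I (\<lambda>s. min (h 0 s) \<delta>)"
      using hdec by (intro I_mono mV min.mono) auto
    moreover have "I (\<lambda>s. min (h 0 s) \<delta>) = phi (\<lambda>w. min (k 0 w) \<delta>)"
      using phi_I[OF mV[of 0]] by (simp add: hk)
    ultimately show ?thesis using d(2) phik[of n] by (intro exI[of _ n]) linarith
  qed
qed

text \<open>Minimal structures agree only up to completion, but each one is a restriction of the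
  Jordan structure. Tightness passes upwards, since a larger ring offers more covers, and countable
  additivity passes downwards.\<close>

lemma countably_additive_minimal:
  assumes min: "minimal_structure (represents H \<A> m X X') \<R> \<mu>"
    and T: "topspace T = UNIV" "closedin T (range X')"
    and cont: "\<And>h. h \<in> H \<Longrightarrow> continuous_map T euclideanreal h"
    and alt: "(\<forall>h\<in>H. compact_support T h) \<or> tight \<R> \<mu> T X' \<or>
      (tight \<A> m T X \<and> inner_val \<A> m {w. X w \<notin> range X'} = 0)"
  shows "is_countably_additive \<R> \<mu>"
proof -
  have "struct_le \<R> \<mu> \<J> \<nu>"
    using min J.measure_structure_jordan represents_jordan by (simp add: minimal_structure_def)
  note sub = J.jordan_complete[OF this]
  have "tight \<J> \<nu> T X'" if "tight \<R> \<mu> T X'"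
  proof -
    have "outer_val \<J> \<nu> E \<le> outer_val \<R> \<mu> E" for E
      unfolding outer_val_def
    proof (rule INF_greatest)
      fix B assume "B \<in> {B \<in> \<R>. E \<subseteq> B}"
      then show "(INF B\<in>{B \<in> \<J>. E \<subseteq> B}. ennreal (\<nu> B)) \<le> ennreal (\<mu> B)"
        using sub[of B] by (intro INF_lower2[of B]) auto
    qed
    then show ?thesis using that unfolding tight_def by (meson le_less_trans)
  qed
  then have "is_countably_additive \<J> \<nu>"
    using alt by (intro countably_additive_jordan[OF T cont]) auto
  then show ?thesis
    unfolding is_countably_additive_def
  proof (intro allI impI)
    fix E :: "nat \<Rightarrow> 'c set"
    assume *: "\<forall>E. range E \<subseteq> \<J> \<longrightarrow> disjoint_family E \<longrightarrow> (\<Union>n. E n) \<in> \<J> \<longrightarrow>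
        (\<lambda>n. \<nu> (E n)) sums \<nu> (\<Union>n. E n)"
      and E: "range E \<subseteq> \<R>" "disjoint_family E" "(\<Union>n. E n) \<in> \<R>"
    have En: "E n \<in> \<R>" for n using E(1) by blast
    have "(\<lambda>n. \<nu> (E n)) sums \<nu> (\<Union>n. E n)"
      using * E(2) sub(1)[OF En] sub(1)[OF E(3)] by blast
    then show "(\<lambda>n. \<mu> (E n)) sums \<mu> (\<Union>n. E n)"
      using sub(2)[OF En] sub(2)[OF E(3)] by simp
  qed
qed

end

text \<open>The form of (a) reflects that a minimal structure carries no mass which \<open>H\<close>
  does not see. If \<open>H\<close> consists of 0 alone, the inequality holds although the only set
  of the minimal ring is empty. The inequality is therefore matched with the existence of a
  representing probability above \<mu>, and with \<mu> being a probability itself as soon as some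
  integrable \<open>h\<close> has a positive infimum on the image.\<close>

theorem theorem2:
  fixes \<A> :: "'a set set" and m :: "'a set \<Rightarrow> real"
    and X :: "'a \<Rightarrow> 's" and X' :: "'b \<Rightarrow> 's" and H :: "('s \<Rightarrow> real) set"
  assumes "measure_structure \<A> m" and "vector_sublattice H" and "stonean H"
  shows
    "((\<forall>h\<in>integrable_part H \<A> m X.
         fa_integral \<A> m (\<lambda>w. h (X w)) < 0 \<longrightarrow> inf_on_image h X' < 0)
      \<longleftrightarrow> (\<exists>\<R> \<mu>. minimal_structure (represents H \<A> m X X') \<R> \<mu>))
     \<and>
     (\<forall>\<R> \<mu>. minimal_structure (represents H \<A> m X X') \<R> \<mu> \<longrightarrow>
        (((\<exists>\<B> x. measure_structure \<B> x \<and> represents H \<A> m X X' \<B> x \<and>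
                 struct_le \<R> \<mu> \<B> x \<and> is_probability \<B> x)
            \<longleftrightarrow> (\<forall>h\<in>integrable_part H \<A> m X.
                  inf_on_image h X' \<le> ereal (fa_integral \<A> m (\<lambda>w. h (X w)))))
         \<and>
         (is_probability \<R> \<mu> \<longrightarrow>
            (\<forall>h\<in>integrable_part H \<A> m X.
               inf_on_image h X' \<le> ereal (fa_integral \<A> m (\<lambda>w. h (X w)))))
         \<and>
         ((\<exists>h\<in>integrable_part H \<A> m X. 0 < inf_on_image h X') \<longrightarrow>
            (is_probability \<R> \<mu> \<longleftrightarrow>
               (\<forall>h\<in>integrable_part H \<A> m X.
                  inf_on_image h X' \<le> ereal (fa_integral \<A> m (\<lambda>w. h (X w)))))))
        \<and>
        (\<forall>T. topspace T = UNIV \<and> closedin T (range X') \<and>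
             (\<forall>h\<in>H. continuous_map T euclideanreal h) \<and>
             ((\<forall>h\<in>H. compact_support T h) \<or>
              tight \<R> \<mu> T X' \<or>
              (tight \<A> m T X \<and> inner_val \<A> m {w. X w \<notin> range X'} = 0))
             \<longrightarrow> is_countably_additive \<R> \<mu>))"
proof -
  interpret representation \<A> m X X' H
    by unfold_locales (use assms in auto)
  have compat: "(\<forall>h\<in>integrable_part H \<A> m X.
      fa_integral \<A> m (\<lambda>w. h (X w)) < 0 \<longrightarrow> inf_on_image h X' < 0) \<longleftrightarrow> compatible"
    by (simp add: compatible_def V_def I_def inf_on_image_less_0_iff)
  have domin: "(\<forall>h\<in>integrable_part H \<A> m X.
      inf_on_image h X' \<le> ereal (fa_integral \<A> m (\<lambda>w. h (X w)))) \<longleftrightarrow> dominates_inf"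
    by (simp add: dominates_inf_def V_def I_def)
  have loc: "compatible_representation \<A> m X X' H" if compatible
    using that by unfold_locales
  have minc: compatible if "minimal_structure (represents H \<A> m X X') \<R> \<mu>" for \<R> \<mu>
    using that represents_compatible by (auto simp: minimal_structure_def)
  show ?thesis
    unfolding compat domin unfolding V_def[symmetric]
  proof (intro conjI allI impI)
    show "compatible \<longleftrightarrow> (\<exists>\<R> \<mu>. minimal_structure (represents H \<A> m X X') \<R> \<mu>)"
      using minc compatible_representation.minimal_jordan[OF loc] by blast
    fix \<R> \<mu> assume min: "minimal_structure (represents H \<A> m X X') \<R> \<mu>"
    then have R: "measure_structure \<R> \<mu>" "represents H \<A> m X X' \<R> \<mu>"
      by (auto simp: minimal_structure_def)
    note C = loc[OF minc[OF min]]
    show "(\<exists>\<B> x. measure_structure \<B> x \<and> represents H \<A> m X X' \<B> x \<and>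
        struct_le \<R> \<mu> \<B> x \<and> is_probability \<B> x) \<longleftrightarrow> dominates_inf"
    proof
      assume dominates_inf
      then obtain \<B> x where B: "measure_structure \<B> x" "represents H \<A> m X X' \<B> x" "is_probability \<B> x"
        using compatible_representation.probability_representation[OF C] by metis
      then show "\<exists>\<B> x. measure_structure \<B> x \<and> represents H \<A> m X X' \<B> x \<and>
          struct_le \<R> \<mu> \<B> x \<and> is_probability \<B> x"
        using min unfolding minimal_structure_def by blast
    qed (use probability_dominates_inf in blast)
    show dominates_inf if "is_probability \<R> \<mu>"
      using probability_dominates_inf[OF R that] .
    show "is_probability \<R> \<mu> \<longleftrightarrow> dominates_inf" if "\<exists>h\<in>V. 0 < inf_on_image h X'"
      using that probability_dominates_inf[OF R] dominates_inf_probability[OF R] by blast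
    show "is_countably_additive \<R> \<mu>"
      if "topspace T = UNIV \<and> closedin T (range X') \<and>
             (\<forall>h\<in>H. continuous_map T euclideanreal h) \<and>
             ((\<forall>h\<in>H. compact_support T h) \<or>
              tight \<R> \<mu> T X' \<or>
              (tight \<A> m T X \<and> inner_val \<A> m {w. X w \<notin> range X'} = 0))" for T
      using compatible_representation.countably_additive_minimal[OF C min, of T] that by blast
  qed
qed

end
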